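(* Let $R$ be an integral domain which is a finitely generated $\mathbb{N}$-graded algebra over a Noetherian ring, and let $I$ be a non-zero homogeneous ideal of $R$ generated by homogeneous elements of degrees $d_1,\dots,d_c\in\mathbb{N}$. Let $\mathcal{A}(I)$ be the set of asymptotic associated primes of $I$, i.e. $\mathcal{A}(I)=\operatorname{Ass}(R/I^n)$ for all large $n$. Then for every $P\in\mathcal{A}(I)$ the function $n\mapsto v_P(I^n)$ is eventually linear in $n$ with leading coefficient in the set $\{d_1,\dots,d_c\}$; that is, there exist $a\in\{d_1,\dots,d_c\}$, $b\in\mathbb{Z}$ and $n_0\in\mathbb{N}$ such that $v_P(I^n)=an+b$ for all $n\ge n_0$.
   Context: Rings are commutative with unit, and $\mathbb{N}$ contains $0$. $R=\bigoplus_{u\in\mathbb{N}}R_u$ denotes the grading of $R$, where the Noetherian base ring maps into $R_0$. For a homogeneous ideal $J$ of $R$ and $P\in\operatorname{Ass}(R/J)$, the $v$-invariant of $J$ at $P$ is $$v_P(J)=\min\{u\in\mathbb{N} : \text{there exists } f\in R_u \text{ such that } P=J:f\},$$ where $J:f=\{r\in R: rf\in J\}$. By a classical theorem of Brodmann, $\operatorname{Ass}(R/I^n)$ is constant for large $n$, so $\mathcal{A}(I)$ is well defined; for $P\in\mathcal{A}(I)$ the number $v_P(I^n)$ is defined for all large $n$. *)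

theory Defs
  imports "HOL-Algebra.Algebra"
begin

text \<open>An $\mathbb{N}$-graded commutative ring: \<open>G u\<close> is the component of degree \<open>u\<close>, and \<open>decomp\<close>
  says that \<open>R\<close> is the internal direct sum of the \<open>G u\<close>. That the unit lies in \<open>G 0\<close> is a
  consequence of these assumptions.\<close>

locale graded_ring = cring R for R (structure) +
  fixes G :: "nat \<Rightarrow> 'a set"
  assumes component: "additive_subgroup (G u) R"
    and mult_component: "\<lbrakk> x \<in> G u; y \<in> G v \<rbrakk> \<Longrightarrow> x \<otimes> y \<in> G (u + v)"
    and decomp: "x \<in> carrier R \<Longrightarrow>
      \<exists>!f. (\<forall>u. f u \<in> G u) \<and> finite {u. f u \<noteq> \<zero>} \<and> x = (\<Oplus>u\<in>{u. f u \<noteq> \<zero>}. f u)"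

text \<open>The algebra structure is the ring homomorphism \<open>\<phi>\<close> from the base ring, which need not be
  injective; the subalgebra generated by a set \<open>S\<close> is the subring generated by \<open>S\<close> together with
  the image of \<open>\<phi>\<close>.\<close>

locale fg_graded_algebra = graded_ring R G + base: cring A
  for A :: "('b, 'n) ring_scheme" and R :: "('a, 'm) ring_scheme" (structure) and G +
  fixes \<phi> :: "'b \<Rightarrow> 'a"
  assumes structure_hom: "\<phi> \<in> ring_hom A R"
    and base_degree_zero: "\<phi> ` carrier A \<subseteq> G 0"
    and finitely_generated:
      "\<exists>S \<subseteq> carrier R. finite S \<and> generate_ring R (\<phi> ` carrier A \<union> S) = carrier R"

definition colon :: "('a, 'm) ring_scheme \<Rightarrow> 'a set \<Rightarrow> 'a \<Rightarrow> 'a set"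
  where "colon R J f = {r \<in> carrier R. r \<otimes>\<^bsub>R\<^esub> f \<in> J}"

text \<open>The associated primes of the \<open>R\<close>-module \<open>R/J\<close>: the annihilator of the class of \<open>f\<close> in
  \<open>R/J\<close> is \<open>J : f\<close>.\<close>

definition ass_quot :: "('a, 'm) ring_scheme \<Rightarrow> 'a set \<Rightarrow> 'a set set"
  where "ass_quot R J = {P. primeideal P R \<and> (\<exists>f \<in> carrier R. P = colon R J f)}"

text \<open>Powers of ideals are the powers in the multiplicative monoid of ideals, so the zeroth power
  is the whole ring.\<close>

abbreviation ideal_pow :: "('a, 'm) ring_scheme \<Rightarrow> 'a set \<Rightarrow> nat \<Rightarrow> 'a set"
  where "ideal_pow R I n \<equiv> I [^]\<^bsub>ideals_set R\<^esub> n"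

text \<open>The ideals \<open>P\<close> lying in \<open>Ass(R/I^n)\<close> for all large \<open>n\<close>. Whenever the sequence \<open>Ass(R/I^n)\<close>
  stabilizes (Brodmann's theorem) this is its stable value, by \<open>asymptotic_ass_eq\<close>.\<close>

definition asymptotic_ass :: "('a, 'm) ring_scheme \<Rightarrow> 'a set \<Rightarrow> 'a set set"
  where "asymptotic_ass R I = {P. \<exists>N. \<forall>n\<ge>N. P \<in> ass_quot R (ideal_pow R I n)}"

lemma asymptotic_ass_eq:
  assumes "\<And>n. n \<ge> N \<Longrightarrow> ass_quot R (ideal_pow R I n) = B"
  shows "asymptotic_ass R I = B"
proof
  show "asymptotic_ass R I \<subseteq> B"
  proof
    fix P assume "P \<in> asymptotic_ass R I"
    then obtain M where "\<forall>n\<ge>M. P \<in> ass_quot R (ideal_pow R I n)"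
      by (auto simp: asymptotic_ass_def)
    then have "P \<in> ass_quot R (ideal_pow R I (max M N))" by simp
    then show "P \<in> B" using assms[of "max M N"] by simp
  qed
  show "B \<subseteq> asymptotic_ass R I"
    using assms by (auto simp: asymptotic_ass_def)
qed

definition v_inv :: "('a, 'm) ring_scheme \<Rightarrow> (nat \<Rightarrow> 'a set) \<Rightarrow> 'a set \<Rightarrow> 'a set \<Rightarrow> nat"
  where "v_inv R G P J = (LEAST u. \<exists>f \<in> G u. P = colon R J f)"

end

theory Submission
  imports Defs "HOL-Library.Product_Plus"
begin

text \<open>
A homogeneous \<open>f\<close> satisfies \<open>P = I^n : f\<close> if and only if \<open>P\<close> kills \<open>f\<close> modulo \<open>I^n\<close> and \<open>f\<close> does not
vanish in the localization of \<open>R / I^n\<close> at \<open>P\<close> (\<open>eq_colon_iff\<close>). So \<open>v_P(I^n)\<close> is the least degree in which the graded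
modules \<open>M_n = I^n : P\<close> and \<open>N_n = {f. \<exists>s \<notin> P. s f \<in> I^n}\<close> satisfy \<open>M_n \<not>\<subseteq> N_n\<close>. Such a degree exists as soon as
\<open>P\<close> is associated to \<open>I^n\<close>, because associated primes of homogeneous ideals have homogeneous witnesses
(\<open>ass_quot_homogeneous_witness\<close>).

Let \<open>z\<close> run through the given generators of \<open>I\<close> and finitely many homogeneous algebra generators of
\<open>R\<close>. Both families are stable under the monomials in \<open>z\<close>, where a monomial counts with its degree in \<open>R\<close> and
with the number of generators of \<open>I\<close> that it contains. Multiplication by a nonzero generator of \<open>I\<close>,
which lies in \<open>P\<close>, embeds the family \<open>M_n\<close> into the Rees algebra of \<open>I\<close>, because \<open>R\<close> is a domain. The Rees
algebra is generated over a Noetherian ring by finitely many elements, so there are finitely many homogeneous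
\<open>f_j\<close> such that every homogeneous element of \<open>M_n\<close> is a combination, over the base ring, of products \<open>z^w f_j\<close> of the right bidegree
(\<open>finitely_generated_family\<close>). If the combination is not in \<open>N_n\<close>, then one of these products is not.
Hence \<open>v_P(I^n)\<close> is the least degree of a product \<open>z^w f_j\<close> at level \<open>n\<close> that is not in \<open>N_n\<close>.

What remains is combinatorial. For each \<open>j\<close> the exponents \<open>w\<close> with \<open>z^w f_j \<notin> N_n\<close> are closed
downwards, as \<open>N\<close> is stable under monomials. By Dickson's lemma they form finitely many translates of coordinate
subspaces, on each of which the least degree at level \<open>n\<close> is linear in \<open>n\<close> with slope the least degree
of a free generator of \<open>I\<close>; translates without such a generator reach only finitely many levels. The least of finitely many lines is eventually a single line
(\<open>least_degree_eventually_linear\<close>), which gives the slope in \<open>{d_1, \<dots>, d_c}\<close>.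

The finite generation is proved directly for families of \<open>A\<close>-submodules spanned by monomials in
\<open>R\<close>, by comparing ideals of leading coefficients in the base ring. The same truncation principle
(\<open>monotone_family_determined_by_trunc\<close>) controls these ideals and the down-closed sets of exponents.
\<close>

section \<open>Dickson's lemma\<close>

lemma nat_seq_incseq_subseq:
  fixes s :: "nat \<Rightarrow> nat"
  obtains r where "strict_mono r" "incseq (\<lambda>n. s (r n))"
proof -
  obtain r where r: "strict_mono r" "monoseq (\<lambda>n. s (r n))"
    using seq_monosub[of s] by blast
  show thesis
  proof (cases "incseq (\<lambda>n. s (r n))")
    case True
    with r show ?thesis using that by blast
  next
    case False
    then have dec: "decseq (\<lambda>n. s (r n))"
      using r(2) by (simp add: monoseq_iff)
    define k where "k = (LEAST v. v \<in> range (\<lambda>n. s (r n)))"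
    have "k \<in> range (\<lambda>n. s (r n))"
      unfolding k_def by (rule LeastI[of _ "s (r 0)"]) auto
    then obtain n0 where n0: "s (r n0) = k" by auto
    have "s (r (n + n0)) = k" for n
    proof (rule antisym)
      show "s (r (n + n0)) \<le> k" using decseqD[OF dec, of n0 "n + n0"] n0 by simp
      show "k \<le> s (r (n + n0))" unfolding k_def by (rule Least_le) auto
    qed
    then have "incseq (\<lambda>n. s (r (n + n0)))" by (simp add: incseq_def)
    moreover have "strict_mono (\<lambda>n. r (n + n0))"
      using r(1) by (simp add: strict_mono_def)
    ultimately show ?thesis using that by blast
  qed
qed

text \<open>Dickson's lemma in sequence form: one coordinate is straightened out after the other.\<close>

lemma exponent_seq_incseq_subseq:
  fixes e :: "nat \<Rightarrow> nat \<Rightarrow> nat"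
  shows "\<exists>r. strict_mono r \<and> (\<forall>i<m. incseq (\<lambda>n. e (r n) i))"
proof (induction m)
  case 0
  show ?case by (rule exI[of _ id]) (simp add: strict_mono_def)
next
  case (Suc m)
  then obtain r where r: "strict_mono r" "\<forall>i<m. incseq (\<lambda>n. e (r n) i)" by blast
  obtain q where q: "strict_mono q" "incseq (\<lambda>n. e (r (q n)) m)"
    using nat_seq_incseq_subseq[of "\<lambda>n. e (r n) m"] by blast
  have "incseq (\<lambda>n. e (r (q n)) i)" if "i < m" for i
    using r(2) that strict_mono_mono[OF q(1)] by (simp add: incseq_def)
  with q have "\<forall>i<Suc m. incseq (\<lambda>n. e (r (q n)) i)" by (simp add: less_Suc_eq)
  moreover have "strict_mono (\<lambda>n. r (q n))"
    using r(1) q(1) by (simp add: strict_mono_def)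
  ultimately show ?case by blast
qed

definition trunc :: "nat \<Rightarrow> nat \<Rightarrow> (nat \<Rightarrow> nat) \<Rightarrow> nat \<Rightarrow> nat"
  where "trunc m K w = (\<lambda>i. if i < m then min (w i) K else 0)"

lemma finite_range_trunc: "finite (range (trunc m K))"
proof (rule finite_subset)
  show "range (trunc m K) \<subseteq> {f. \<forall>i. (i \<in> {..<m} \<longrightarrow> f i \<in> {..K}) \<and> (i \<notin> {..<m} \<longrightarrow> f i = 0)}"
    by (auto simp: trunc_def)
  show "finite \<dots>" by (rule finite_set_of_finite_funs) auto
qed

lemma trunc_trunc: "trunc m K (trunc m K w) = trunc m K w"
  by (auto simp: trunc_def)

text \<open>A monotone family over the exponents with the ascending chain condition on its values cannot see
coordinates beyond some bound \<open>K\<close>. Otherwise every \<open>K\<close> has a witness \<open>e K\<close> whose value changes under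
truncation at \<open>K\<close>. Along a componentwise increasing subsequence of witnesses the values become
stationary, and a late witness, truncated at its own large bound, still dominates the witness at which they
became stationary; so the truncation did not change the value after all.

It serves twice: for ideals of leading coefficients, where it replaces the Noetherian property of a
polynomial ring, and for sets of generators, where it cuts a down-closed set of exponents into
finitely many translated coordinate subspaces.\<close>

lemma monotone_family_determined_by_trunc:
  fixes L :: "(nat \<Rightarrow> nat) \<Rightarrow> 'c set"
  assumes mono: "\<And>w w'. (\<And>i. i < m \<Longrightarrow> w i \<le> w' i) \<Longrightarrow> L w \<subseteq> L w'"
    and acc: "\<And>C :: nat \<Rightarrow> 'c set. range C \<subseteq> range L \<Longrightarrow> incseq C \<Longrightarrow> \<exists>n. \<forall>k\<ge>n. C k = C n"
  shows "\<exists>K. \<forall>w. L w = L (trunc m K w)"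
proof (rule ccontr)
  assume "\<nexists>K. \<forall>w. L w = L (trunc m K w)"
  then have "\<forall>K. \<exists>w. L w \<noteq> L (trunc m K w)" by blast
  then obtain e where e: "\<And>K. L (e K) \<noteq> L (trunc m K (e K))" by metis
  obtain r where r: "strict_mono r" "\<forall>i<m. incseq (\<lambda>n. e (r n) i)"
    using exponent_seq_incseq_subseq by blast
  have "incseq (\<lambda>n. L (e (r n)))"
    unfolding incseq_def using r(2) by (intro allI impI mono) (auto simp: incseq_def)
  moreover have "range (\<lambda>n. L (e (r n))) \<subseteq> range L" by auto
  ultimately obtain n where n: "\<forall>k\<ge>n. L (e (r k)) = L (e (r n))"
    using acc[of "\<lambda>n. L (e (r n))"] by auto
  define k where "k = n + (\<Sum>i<m. e (r n) i)"
  have k_ge: "k \<ge> n" by (simp add: k_def)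
  \<comment> \<open>\<open>r k \<ge> k\<close> exceeds every coordinate of \<open>e (r n)\<close>, so truncating \<open>e (r k)\<close> at \<open>r k\<close> stays above \<open>e (r n)\<close>.\<close>
  have "e (r n) i \<le> trunc m (r k) (e (r k)) i" if i: "i < m" for i
  proof -
    have "e (r n) i \<le> (\<Sum>i<m. e (r n) i)" using i by (intro member_le_sum) auto
    also have "\<dots> \<le> k" by (simp add: k_def)
    also have "k \<le> r k" using r(1) by (rule seq_suble)
    finally show ?thesis using r(2) i k_ge by (auto simp: trunc_def incseq_def)
  qed
  then have "L (e (r n)) \<subseteq> L (trunc m (r k) (e (r k)))" by (rule mono)
  moreover have "L (trunc m (r k) (e (r k))) \<subseteq> L (e (r k))"
    by (rule mono) (simp add: trunc_def)
  ultimately have "L (e (r k)) = L (trunc m (r k) (e (r k)))"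
    using n k_ge by blast
  with e show False by blast
qed

section \<open>Least degrees along a family of down-closed sets of exponents\<close>

lemma eventually_least_line:
  fixes \<L> :: "(nat \<times> int) set"
  assumes "finite \<L>" "\<L> \<noteq> {}"
  shows "\<exists>(a, b) \<in> \<L>. \<exists>n\<^sub>0. \<forall>n\<ge>n\<^sub>0. \<forall>(a', b') \<in> \<L>. int a * int n + b \<le> int a' * int n + b'"
  using assms
proof (induction rule: finite_ne_induct)
  case (singleton x)
  then show ?case by auto
next
  case (insert x F)
  then obtain a b n0 where ab: "(a, b) \<in> F"
    and n0: "\<And>n a' b'. n \<ge> n0 \<Longrightarrow> (a', b') \<in> F \<Longrightarrow> int a * int n + b \<le> int a' * int n + b'"
    by blast
  obtain a1 b1 where x: "x = (a1, b1)" by (cases x)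
  have lines: "p < a' \<or> p = a' \<and> q \<le> b' \<Longrightarrow> n \<ge> nat (\<bar>q\<bar> + \<bar>b'\<bar>) \<Longrightarrow>
      int p * int n + q \<le> int a' * int n + b'" for p a' n :: nat and q b' :: int
  proof -
    assume "p < a' \<or> p = a' \<and> q \<le> b'" and n: "n \<ge> nat (\<bar>q\<bar> + \<bar>b'\<bar>)"
    then consider "p < a'" | "p = a'" "q \<le> b'" by blast
    then show ?thesis
    proof cases
      case 1
      then have "(int p + 1) * int n \<le> int a' * int n" by (intro mult_right_mono) auto
      with n show ?thesis by (simp add: algebra_simps)
    qed simp
  qed
  show ?case
  proof (cases "a < a1 \<or> a = a1 \<and> b \<le> b1")
    case True
    have "int a * int n + b \<le> int a' * int n + b'"
      if "n \<ge> max n0 (nat (\<bar>b\<bar> + \<bar>b1\<bar>))" "(a', b') \<in> insert x F" for n a' b'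
      using that n0[of n a' b'] lines[OF True, of n] x by auto
    with ab show ?thesis by blast
  next
    case False
    then have less: "a1 < a \<or> a1 = a \<and> b1 \<le> b" by auto
    have "int a1 * int n + b1 \<le> int a' * int n + b'"
      if "n \<ge> max n0 (nat (\<bar>b1\<bar> + \<bar>b\<bar>))" "(a', b') \<in> insert x F" for n a' b'
      using that n0[of n a' b'] lines[OF less, of n] x by force
    with x show ?thesis by blast
  qed
qed

text \<open>The exponents \<open>w\<close> are those of the monomials multiplying a generator \<open>j\<close> of bidegree
\<open>(u\<^sub>0 j, n\<^sub>0 j)\<close>, and \<open>E j w\<close> says that the product survives. Truncation at a suitable \<open>K\<close> decides
\<open>E j w\<close>, so the surviving exponents with a given truncation \<open>t\<close> form \<open>t + \<nat>\<^sup>F\<close>, where the set \<open>F\<close> of free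
coordinates consists of those with \<open>t i = K\<close>. On such a piece the cheapest way to reach level \<open>n\<close> is to raise
only a free coordinate with \<open>\<eta> i = 1\<close> and least \<open>\<delta> i\<close>, at a cost linear in \<open>n\<close> with slope
\<open>\<delta> i\<close>. The pieces are finite in number, and the least of finitely many lines is eventually one of them.\<close>

lemma least_degree_eventually_linear:
  fixes u\<^sub>0 n\<^sub>0 :: "'j \<Rightarrow> nat" and \<delta> \<eta> :: "nat \<Rightarrow> nat"
    and E :: "'j \<Rightarrow> (nat \<Rightarrow> nat) \<Rightarrow> bool" and D :: "nat \<Rightarrow> nat set"
  assumes fin: "finite J"
    and eta: "\<And>i. i < m \<Longrightarrow> \<eta> i \<le> 1"
    and down: "\<And>j w w'. j \<in> J \<Longrightarrow> E j w' \<Longrightarrow> (\<And>i. i < m \<Longrightarrow> w i \<le> w' i) \<Longrightarrow> E j w"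
    and D: "\<And>n. D n = {u\<^sub>0 j + (\<Sum>i<m. \<delta> i * w i) | j w.
              j \<in> J \<and> E j w \<and> n\<^sub>0 j + (\<Sum>i<m. \<eta> i * w i) = n}"
    and ne: "\<And>n. n \<ge> N \<Longrightarrow> D n \<noteq> {}"
  shows "\<exists>i<m. \<eta> i = 1 \<and> (\<exists>(b :: int) n\<^sub>1. \<forall>n\<ge>n\<^sub>1. int (LEAST u. u \<in> D n) = int (\<delta> i) * int n + b)"
proof -
  define L where "L w = {j \<in> J. \<not> E j w}" for w
  have "\<exists>K. \<forall>w. L w = L (trunc m K w)"
  proof (rule monotone_family_determined_by_trunc)
    fix w w' :: "nat \<Rightarrow> nat" assume "\<And>i. i < m \<Longrightarrow> w i \<le> w' i"
    then show "L w \<subseteq> L w'" using down unfolding L_def by blast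
  next
    fix C :: "nat \<Rightarrow> 'j set" assume C: "range C \<subseteq> range L" "incseq C"
    have sub: "C n \<subseteq> J" for n using C(1) unfolding L_def by blast
    have "finite (range C)" by (rule finite_subset[of _ "Pow J"]) (use sub fin in auto)
    then obtain M where M: "M \<in> range C" "\<And>Y. Y \<in> range C \<Longrightarrow> M \<subseteq> Y \<Longrightarrow> M = Y"
      using finite_has_maximal[of "range C"] by blast
    then obtain n where "M = C n" using M(1) by auto
    then have "\<forall>k\<ge>n. C k = C n" using M(2) C(2) by (metis incseqD rangeI)
    then show "\<exists>n. \<forall>k\<ge>n. C k = C n" by blast
  qed
  then obtain K where K: "\<And>w. L w = L (trunc m K w)" by blast
  have E_trunc: "E j w \<longleftrightarrow> E j (trunc m K w)" if "j \<in> J" for j w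
    using K[of w] that unfolding L_def by blast
  define dg where "dg w = (\<Sum>i<m. \<delta> i * w i)" for w
  define yd where "yd w = (\<Sum>i<m. \<eta> i * w i)" for w
  define T where "T = {(j, t) \<in> J \<times> range (trunc m K). E j t}"
  have finT: "finite T"
    unfolding T_def by (rule finite_subset[of _ "J \<times> range (trunc m K)"]) (use fin finite_range_trunc in auto)
  define Y where "Y t = {i. i < m \<and> t i = K \<and> \<eta> i = 1}" for t :: "nat \<Rightarrow> nat"
  \<comment> \<open>One line for each piece and each of its free coordinates of level one: the degrees reached by raising that coordinate alone.\<close>
  define \<L> where "\<L> = (\<lambda>((j, t), i). (\<delta> i, int (u\<^sub>0 j + dg t) - int (\<delta> i) * int (n\<^sub>0 j + yd t))) ` 
    (SIGMA jt : T. Y (snd jt))"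
  have finL: "finite \<L>"
    unfolding \<L>_def using finT by (intro finite_imageI finite_SigmaI) (auto simp: Y_def)
  \<comment> \<open>Beyond level \<open>B\<close> no piece is represented by its corner, so a coordinate of level one has been raised.\<close>
  define B where "B = Suc (\<Sum>(j, t)\<in>T. n\<^sub>0 j + yd t)"
  have B: "n\<^sub>0 j + yd t < B" if "(j, t) \<in> T" for j t
  proof -
    have "(\<lambda>(j, t). n\<^sub>0 j + yd t) (j, t) \<le> (\<Sum>(j, t)\<in>T. n\<^sub>0 j + yd t)"
      using that finT by (intro member_le_sum) auto
    then show ?thesis by (simp add: B_def)
  qed
  have attained: "\<exists>u \<in> D n. int u = int a * int n + b" if n: "n \<ge> B" and ab: "(a, b) \<in> \<L>" for n a b
  proof -
    obtain j t i where jt: "(j, t) \<in> T" and i: "i \<in> Y t"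
      and a: "a = \<delta> i" and b: "b = int (u\<^sub>0 j + dg t) - int (\<delta> i) * int (n\<^sub>0 j + yd t)"
      using ab unfolding \<L>_def by auto
    define k where "k = n - (n\<^sub>0 j + yd t)"
    have k: "n = n\<^sub>0 j + yd t + k" using B[OF jt] n by (simp add: k_def)
    define w where "w = (\<lambda>l. if l = i then t l + k else t l)"
    have im: "i < m" "t i = K" "\<eta> i = 1" using i by (auto simp: Y_def)
    obtain w0 where w0: "t = trunc m K w0" and j: "j \<in> J" and Ejt: "E j t"
      using jt by (auto simp: T_def)
    have "trunc m K w = trunc m K t"
      using im by (auto simp: trunc_def w_def fun_eq_iff)
    also have "\<dots> = t" by (simp add: w0 trunc_trunc)
    finally have "E j w" using E_trunc[OF j, of w] Ejt by simp
    moreover have sum: "(\<Sum>l<m. f l * w l) = (\<Sum>l<m. f l * t l) + f i * k" for f :: "nat \<Rightarrow> nat"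
    proof -
      have "(\<Sum>l<m. f l * w l) = (\<Sum>l<m. f l * t l + (if l = i then f l * k else 0))"
        by (intro sum.cong) (auto simp: w_def algebra_simps)
      also have "\<dots> = (\<Sum>l<m. f l * t l) + f i * k"
        using im(1) by (simp add: sum.distrib)
      finally show ?thesis .
    qed
    ultimately have "u\<^sub>0 j + (dg t + \<delta> i * k) \<in> D n"
      using j k im(3) sum[of \<delta>] sum[of \<eta>] unfolding D dg_def yd_def
      by (intro CollectI exI[of _ j] exI[of _ w]) simp
    moreover have "int (u\<^sub>0 j + (dg t + \<delta> i * k)) = int a * int n + b"
      unfolding a b k by (simp add: algebra_simps)
    ultimately show ?thesis by blast
  qed
  have dominated: "\<exists>(a, b) \<in> \<L>. int a * int n + b \<le> int u" if n: "n \<ge> B" and u: "u \<in> D n" for n u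
  proof -
    obtain j w where j: "j \<in> J" and Ew: "E j w" and u: "u = u\<^sub>0 j + dg w" and yw: "n\<^sub>0 j + yd w = n"
      using u unfolding D dg_def yd_def by auto
    define t where "t = trunc m K w"
    have jt: "(j, t) \<in> T" using j Ew E_trunc[OF j, of w] by (auto simp: T_def t_def)
    have split: "(\<Sum>l<m. f l * w l) = (\<Sum>l<m. f l * t l) + (\<Sum>l<m. f l * (w l - t l))" for f :: "nat \<Rightarrow> nat"
    proof -
      have "(\<Sum>l<m. f l * w l) = (\<Sum>l<m. f l * t l + f l * (w l - t l))"
        by (intro sum.cong) (auto simp: t_def trunc_def simp flip: distrib_left)
      then show ?thesis by (simp add: sum.distrib)
    qed
    define q where "q = (\<Sum>l<m. \<eta> l * (w l - t l))"
    have q: "yd w = yd t + q" unfolding yd_def q_def by (rule split)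
    have "q \<noteq> 0" using B[OF jt] n yw q by auto
    then obtain l where l: "l < m" "\<eta> l * (w l - t l) \<noteq> 0" unfolding q_def by (meson lessThan_iff sum.not_neutral_contains_not_neutral)
    have inY: "l \<in> Y t" if "l < m" "\<eta> l * (w l - t l) \<noteq> 0" for l
      using that eta[of l] by (auto simp: Y_def t_def trunc_def min_def split: if_splits)
    have Yne: "Y t \<noteq> {}" using inY[OF l] by blast
    have finY: "finite (Y t)" by (simp add: Y_def)
    define i where "i = arg_min_on \<delta> (Y t)"
    have i: "i \<in> Y t" "\<And>l. l \<in> Y t \<Longrightarrow> \<delta> i \<le> \<delta> l"
      using arg_min_if_finite(1)[OF finY Yne] arg_min_least[OF finY Yne] by (auto simp: i_def)
    have "\<delta> i * q \<le> (\<Sum>l<m. \<delta> l * (w l - t l))"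
      unfolding q_def sum_distrib_left
    proof (rule sum_mono)
      fix l assume "l \<in> {..<m}"
      then show "\<delta> i * (\<eta> l * (w l - t l)) \<le> \<delta> l * (w l - t l)"
        using i(2)[OF inY[of l]] eta[of l]
        by (cases "\<eta> l * (w l - t l) = 0") (auto simp: le_Suc_eq)
    qed
    then have "u\<^sub>0 j + dg t + \<delta> i * q \<le> u" using split[of \<delta>] unfolding u dg_def by simp
    moreover have "int (\<delta> i) * int n + (int (u\<^sub>0 j + dg t) - int (\<delta> i) * int (n\<^sub>0 j + yd t)) = int (u\<^sub>0 j + dg t + \<delta> i * q)"
      unfolding yw[symmetric] q by (simp add: algebra_simps)
    moreover have "(\<delta> i, int (u\<^sub>0 j + dg t) - int (\<delta> i) * int (n\<^sub>0 j + yd t)) \<in> \<L>"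
      unfolding \<L>_def using jt i(1) by (intro image_eqI[of _ _ "((j, t), i)"]) auto
    ultimately show ?thesis by (metis (no_types, lifting) case_prodI of_nat_le_iff)
  qed
  have "\<L> \<noteq> {}" using dominated[of "max B N"] ne[of "max B N"] by fastforce
  then obtain a b n1 where ab: "(a, b) \<in> \<L>"
    and n1: "\<And>n a' b'. n \<ge> n1 \<Longrightarrow> (a', b') \<in> \<L> \<Longrightarrow> int a * int n + b \<le> int a' * int n + b'"
    using eventually_least_line[OF finL] by blast
  have "int (LEAST u. u \<in> D n) = int a * int n + b" if n: "n \<ge> max n1 B" for n
  proof -
    obtain u where u: "u \<in> D n" "int u = int a * int n + b" using attained[of n a b] n ab by auto
    have "u \<le> u'" if u': "u' \<in> D n" for u'
      using dominated[OF _ u'] n1[of n] n u(2) by fastforce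
    then have "(LEAST u. u \<in> D n) = u" using u(1) by (intro Least_equality)
    then show ?thesis using u(2) by simp
  qed
  moreover obtain i where "i < m" "\<eta> i = 1" "a = \<delta> i" using ab unfolding \<L>_def Y_def by auto
  ultimately show ?thesis by blast
qed

section \<open>Spans over the base ring\<close>

text \<open>The ring \<open>R\<close> is treated as a module over the base ring \<open>A\<close> through \<open>\<phi>\<close>.\<close>

locale algebra_map = cring R + base: cring A
  for A :: "('b, 'n) ring_scheme" and R :: "('a, 'm) ring_scheme" (structure) +
  fixes \<phi> :: "'b \<Rightarrow> 'a"
  assumes hom: "\<phi> \<in> ring_hom A R"
begin

lemma phi_closed [simp]: "a \<in> carrier A \<Longrightarrow> \<phi> a \<in> carrier R"
  using hom by (rule ring_hom_closed)

lemma phi_add: "a \<in> carrier A \<Longrightarrow> b \<in> carrier A \<Longrightarrow> \<phi> (a \<oplus>\<^bsub>A\<^esub> b) = \<phi> a \<oplus> \<phi> b"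
  using hom by (rule ring_hom_add)

lemma phi_mult: "a \<in> carrier A \<Longrightarrow> b \<in> carrier A \<Longrightarrow> \<phi> (a \<otimes>\<^bsub>A\<^esub> b) = \<phi> a \<otimes> \<phi> b"
  using hom by (rule ring_hom_mult)

lemma phi_one [simp]: "\<phi> \<one>\<^bsub>A\<^esub> = \<one>"
  using hom by (rule ring_hom_one)

lemma phi_zero [simp]: "\<phi> \<zero>\<^bsub>A\<^esub> = \<zero>"
  using ring_hom_zero[OF hom base.ring_axioms ring_axioms] .

lemma phi_neg_mult: "x \<in> carrier R \<Longrightarrow> \<phi> (\<ominus>\<^bsub>A\<^esub> \<one>\<^bsub>A\<^esub>) \<otimes> x = \<ominus> x"
proof -
  assume x: "x \<in> carrier R"
  have "\<phi> (\<ominus>\<^bsub>A\<^esub> \<one>\<^bsub>A\<^esub>) \<oplus> \<one> = \<phi> (\<ominus>\<^bsub>A\<^esub> \<one>\<^bsub>A\<^esub> \<oplus>\<^bsub>A\<^esub> \<one>\<^bsub>A\<^esub>)"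
    by (simp add: phi_add)
  then have "\<phi> (\<ominus>\<^bsub>A\<^esub> \<one>\<^bsub>A\<^esub>) \<oplus> \<one> = \<zero>"
    by (simp add: base.l_neg)
  then have "\<phi> (\<ominus>\<^bsub>A\<^esub> \<one>\<^bsub>A\<^esub>) = \<ominus> \<one>"
    using minus_equality by simp
  with x show ?thesis by (simp add: l_minus)
qed

definition submod :: "'a set \<Rightarrow> bool"
  where "submod M \<longleftrightarrow> M \<subseteq> carrier R \<and> \<zero> \<in> M \<and> (\<forall>x\<in>M. \<forall>y\<in>M. x \<oplus> y \<in> M)
    \<and> (\<forall>a\<in>carrier A. \<forall>x\<in>M. \<phi> a \<otimes> x \<in> M)"

lemma submodI:
  assumes "M \<subseteq> carrier R" "\<zero> \<in> M" "\<And>x y. x \<in> M \<Longrightarrow> y \<in> M \<Longrightarrow> x \<oplus> y \<in> M"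
    "\<And>a x. a \<in> carrier A \<Longrightarrow> x \<in> M \<Longrightarrow> \<phi> a \<otimes> x \<in> M"
  shows "submod M"
  using assms by (auto simp: submod_def)

lemma submod_carrier: "submod M \<Longrightarrow> x \<in> M \<Longrightarrow> x \<in> carrier R"
  and submod_zero: "submod M \<Longrightarrow> \<zero> \<in> M"
  and submod_add: "submod M \<Longrightarrow> x \<in> M \<Longrightarrow> y \<in> M \<Longrightarrow> x \<oplus> y \<in> M"
  and submod_smult: "submod M \<Longrightarrow> a \<in> carrier A \<Longrightarrow> x \<in> M \<Longrightarrow> \<phi> a \<otimes> x \<in> M"
  by (auto simp: submod_def)

lemma submod_minus: "submod M \<Longrightarrow> x \<in> M \<Longrightarrow> y \<in> M \<Longrightarrow> x \<ominus> y \<in> M"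
  using submod_smult[of M "\<ominus>\<^bsub>A\<^esub> \<one>\<^bsub>A\<^esub>" y] submod_carrier[of M y] submod_add[of M x "\<ominus> y"]
  by (simp add: phi_neg_mult a_minus_def)

inductive_set aspan :: "'a set \<Rightarrow> 'a set" for B :: "'a set"
  where zero: "\<zero> \<in> aspan B"
  | add: "x \<in> aspan B \<Longrightarrow> y \<in> aspan B \<Longrightarrow> x \<oplus> y \<in> aspan B"
  | smult: "a \<in> carrier A \<Longrightarrow> b \<in> B \<Longrightarrow> \<phi> a \<otimes> b \<in> aspan B"

lemma aspan_carrier: "x \<in> aspan B \<Longrightarrow> B \<subseteq> carrier R \<Longrightarrow> x \<in> carrier R"
  by (induction rule: aspan.induct) auto

lemma aspan_incl: "B \<subseteq> carrier R \<Longrightarrow> b \<in> B \<Longrightarrow> b \<in> aspan B"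
  using aspan.smult[of "\<one>\<^bsub>A\<^esub>" b B] by auto

lemma aspan_submod: "B \<subseteq> carrier R \<Longrightarrow> submod (aspan B)"
proof (rule submodI)
  fix a x assume B: "B \<subseteq> carrier R" and a: "a \<in> carrier A" and x: "x \<in> aspan B"
  show "\<phi> a \<otimes> x \<in> aspan B"
    using x
  proof (induction rule: aspan.induct)
    case zero
    then show ?case using a by (simp add: aspan.zero)
  next
    case (add x y)
    then show ?case using a B by (simp add: r_distr aspan_carrier aspan.add)
  next
    case (smult c b)
    then have "\<phi> a \<otimes> (\<phi> c \<otimes> b) = \<phi> (a \<otimes>\<^bsub>A\<^esub> c) \<otimes> b"
      using a B by (simp add: phi_mult m_assoc subset_iff)
    then show ?case using smult a by (metis aspan.smult base.m_closed)
  qed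
qed (auto intro: aspan.intros aspan_carrier)

lemma aspan_minimal: "submod M \<Longrightarrow> B \<subseteq> M \<Longrightarrow> aspan B \<subseteq> M"
proof
  fix x assume M: "submod M" "B \<subseteq> M" and x: "x \<in> aspan B"
  show "x \<in> M"
    using x by (induction rule: aspan.induct) (use M in \<open>auto simp: submod_def\<close>)
qed

lemma aspan_mono: "B \<subseteq> B' \<Longrightarrow> aspan B \<subseteq> aspan B'"
proof
  fix x assume "B \<subseteq> B'" and x: "x \<in> aspan B"
  show "x \<in> aspan B'" using x by (induction rule: aspan.induct) (use \<open>B \<subseteq> B'\<close> in \<open>auto intro: aspan.intros\<close>)
qed

lemma mult_aspan:
  assumes "x \<in> aspan B" "r \<in> carrier R" "B \<subseteq> carrier R" "B' \<subseteq> carrier R"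
    and "\<And>b. b \<in> B \<Longrightarrow> r \<otimes> b \<in> aspan B'"
  shows "r \<otimes> x \<in> aspan B'"
  using assms(1)
proof (induction rule: aspan.induct)
  case zero
  then show ?case using assms by (simp add: aspan.zero)
next
  case (add x y)
  then show ?case using assms by (simp add: r_distr aspan_carrier aspan.add)
next
  case (smult a b)
  then have "r \<otimes> (\<phi> a \<otimes> b) = \<phi> a \<otimes> (r \<otimes> b)"
    using assms by (auto intro: m_lcomm)
  then show ?case using smult assms(5) submod_smult[OF aspan_submod[OF assms(4)]] by simp
qed

lemma aspan_mult_aspan:
  assumes "x \<in> aspan B" "y \<in> aspan B'" "B \<subseteq> carrier R" "B' \<subseteq> carrier R" "B'' \<subseteq> carrier R"
    and "\<And>b b'. b \<in> B \<Longrightarrow> b' \<in> B' \<Longrightarrow> b \<otimes> b' \<in> aspan B''"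
  shows "x \<otimes> y \<in> aspan B''"
proof (rule mult_aspan[OF assms(2)])
  show x: "x \<in> carrier R" using assms(1,3) by (rule aspan_carrier)
  fix b' assume b': "b' \<in> B'"
  have "b' \<otimes> x \<in> aspan B''"
    by (rule mult_aspan[OF assms(1)]) (use b' assms in \<open>auto simp: m_comm subset_iff\<close>)
  then show "x \<otimes> b' \<in> aspan B''" using x b' assms(4) by (metis m_comm subsetD)
qed (use assms in auto)

lemma aspan_insert:
  assumes "x \<in> aspan (insert b B)" "b \<in> carrier R" "B \<subseteq> carrier R"
  shows "\<exists>a\<in>carrier A. \<exists>f\<in>aspan B. x = \<phi> a \<otimes> b \<oplus> f"
  using assms(1)
proof (induction rule: aspan.induct)
  case zero
  show ?case using assms by (intro bexI[of _ "\<zero>\<^bsub>A\<^esub>"] bexI[of _ \<zero>]) (auto intro: aspan.zero)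
next
  case (add x y)
  then obtain a f a' f' where "a \<in> carrier A" "f \<in> aspan B" "x = \<phi> a \<otimes> b \<oplus> f"
    "a' \<in> carrier A" "f' \<in> aspan B" "y = \<phi> a' \<otimes> b \<oplus> f'" by blast
  moreover from this have "x \<oplus> y = \<phi> (a \<oplus>\<^bsub>A\<^esub> a') \<otimes> b \<oplus> (f \<oplus> f')"
    using assms aspan_carrier[of _ B] by (simp add: phi_add l_distr a_ac)
  ultimately show ?case by (meson aspan.add base.add.m_closed)
next
  case (smult a b')
  show ?case
  proof (cases "b' = b")
    case True
    then show ?thesis using smult assms by (intro bexI[of _ a] bexI[of _ \<zero>]) (auto intro: aspan.zero)
  next
    case False
    then have "\<phi> a \<otimes> b' \<in> aspan B" using smult by (intro aspan.smult) auto
    then show ?thesis using smult assms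
      by (intro bexI[of _ "\<zero>\<^bsub>A\<^esub>"] bexI[of _ "\<phi> a \<otimes> b'"]) (auto intro: aspan.zero)
  qed
qed

end

lemma (in cring) idealI_closed:
  assumes "L \<subseteq> carrier R" "\<zero> \<in> L" "\<And>x y. x \<in> L \<Longrightarrow> y \<in> L \<Longrightarrow> x \<oplus> y \<in> L"
    "\<And>r x. r \<in> carrier R \<Longrightarrow> x \<in> L \<Longrightarrow> r \<otimes> x \<in> L"
  shows "ideal L R"
proof (rule idealI)
  show "subgroup L (add_monoid R)"
  proof (rule add.subgroupI)
    fix x assume x: "x \<in> L"
    then have "\<ominus> \<one> \<otimes> x \<in> L" using assms(4) by simp
    then show "\<ominus> x \<in> L" using x assms(1) by (simp add: l_minus subset_iff)
  qed (use assms in auto)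
  show "x \<otimes> a \<in> L" if "a \<in> L" "x \<in> carrier R" for a x using assms that by simp
  show "a \<otimes> x \<in> L" if "a \<in> L" "x \<in> carrier R" for a x
    using assms that by (metis m_comm subsetD)
qed (rule ring_axioms)

section \<open>Leading coefficients\<close>

text \<open>Only the coordinates below \<open>m\<close> count, so that finitely many variables can be indexed by natural numbers
without a type of indices; two exponents may therefore be incomparable without being equal as functions.\<close>

definition lex_less :: "nat \<Rightarrow> (nat \<Rightarrow> nat) \<Rightarrow> (nat \<Rightarrow> nat) \<Rightarrow> bool"
  where "lex_less m w w' \<longleftrightarrow> (\<exists>k<m. w k < w' k \<and> (\<forall>i<k. w i = w' i))"

lemma wf_lex_less: "wf {(w, w'). lex_less m w w'}"
proof (rule wf_subset)
  show "wf (inv_image (lex less_than) (\<lambda>w. map w [0..<m]))" by (intro wf_inv_image wf_lex) simp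
  have "(map w [0..<m], map w' [0..<m]) \<in> lex less_than" if less: "lex_less m w w'" for w w'
  proof -
    obtain k where k: "k < m" "w k < w' k" "\<forall>i<k. w i = w' i"
      using less by (auto simp: lex_less_def)
    have split: "map v [0..<m] = map v [0..<k] @ v k # map v [Suc k..<m]" for v :: "nat \<Rightarrow> nat"
    proof -
      have "[0..<m] = [0..<k] @ k # [Suc k..<m]"
        using k(1) upt_add_eq_append[of 0 k "m - k"] by (simp add: upt_conv_Cons)
      then show ?thesis by simp
    qed
    have "map w [0..<k] = map w' [0..<k]" using k(3) by simp
    then have "map w' [0..<m] = map w [0..<k] @ w' k # map w' [Suc k..<m]" using split[of w'] by simp
    then show ?thesis
      unfolding lex_conv using k(2) split[of w] by auto
  qed
  then show "{(w, w'). lex_less m w w'} \<subseteq> inv_image (lex less_than) (\<lambda>w. map w [0..<m])"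
    by auto
qed

lemma lex_less_linear: "lex_less m w w' \<or> lex_less m w' w \<or> (\<forall>i<m. w i = w' i)"
proof (rule ccontr)
  assume *: "\<not> ?thesis"
  define k where "k = (LEAST i. i < m \<and> w i \<noteq> w' i)"
  have "\<exists>i. i < m \<and> w i \<noteq> w' i" using * by blast
  then have k: "k < m \<and> w k \<noteq> w' k" unfolding k_def by (rule LeastI_ex)
  have "w i = w' i" if "i < k" for i
    using not_less_Least[of i "\<lambda>i. i < m \<and> w i \<noteq> w' i"] that k unfolding k_def by auto
  then show False using * k unfolding lex_less_def by (metis linorder_neqE_nat)
qed

lemma lex_less_trans: "lex_less m w1 w2 \<Longrightarrow> lex_less m w2 w3 \<Longrightarrow> lex_less m w1 w3"
proof -
  assume "lex_less m w1 w2" "lex_less m w2 w3"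
  then obtain k l where k: "k < m" "w1 k < w2 k" "\<forall>i<k. w1 i = w2 i"
    and l: "l < m" "w2 l < w3 l" "\<forall>i<l. w2 i = w3 i"
    unfolding lex_less_def by blast
  then have "w1 (min k l) < w3 (min k l)" by (cases k l rule: linorder_cases) auto
  with k l show ?thesis unfolding lex_less_def by (intro exI[of _ "min k l"]) auto
qed

lemma lex_less_add: "lex_less m w w' \<Longrightarrow> lex_less m (\<lambda>i. w i + v i) (\<lambda>i. w' i + v i)"
  unfolding lex_less_def by auto

lemma lex_less_cong: "lex_less m w w' \<Longrightarrow> (\<And>i. i < m \<Longrightarrow> w' i = w'' i) \<Longrightarrow> lex_less m w w''"
  unfolding lex_less_def by (metis less_trans)

text \<open>The weight takes values in an arbitrary cancellative monoid, because later it is the pair of the degree in \<open>R\<close> and the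
power of the ideal; the map \<open>w \<mapsto> mon w\<close> need not be injective.\<close>

locale weighted_monomials = algebra_map A R \<phi>
  for A :: "('b, 'n) ring_scheme" and R :: "('a, 'm) ring_scheme" (structure) and \<phi> +
  fixes m :: nat and z :: "nat \<Rightarrow> 'a" and wt :: "(nat \<Rightarrow> nat) \<Rightarrow> 'g :: cancel_comm_monoid_add"
  assumes z_closed: "i < m \<Longrightarrow> z i \<in> carrier R"
    and wt_add: "wt (\<lambda>i. w i + v i) = wt w + wt v"
    and wt_cong: "(\<And>i. i < m \<Longrightarrow> w i = v i) \<Longrightarrow> wt w = wt v"
begin

definition mon :: "(nat \<Rightarrow> nat) \<Rightarrow> 'a"
  where "mon w = (\<Otimes>i\<in>{..<m}. z i [^] w i)"

lemma mon_closed [simp]: "mon w \<in> carrier R"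
  unfolding mon_def using z_closed by (intro finprod_closed) auto

lemma mon_add: "mon (\<lambda>i. w i + v i) = mon w \<otimes> mon v"
proof -
  have "(\<Otimes>i\<in>{..<m}. z i [^] (w i + v i)) = (\<Otimes>i\<in>{..<m}. z i [^] w i \<otimes> z i [^] v i)"
    using z_closed by (intro finprod_cong') (auto simp: nat_pow_mult)
  also have "\<dots> = mon w \<otimes> mon v"
    unfolding mon_def using z_closed by (intro finprod_multf) auto
  finally show ?thesis by (simp add: mon_def)
qed

lemma mon_cong: "(\<And>i. i < m \<Longrightarrow> w i = v i) \<Longrightarrow> mon w = mon v"
  unfolding mon_def using z_closed by (intro finprod_cong') auto

lemma mon_subset [simp]: "mon ` W \<subseteq> carrier R"
  by auto

text \<open>As monomials may coincide or be dependent in \<open>R\<close>, an element has no leading term of its own. \<open>lead M w\<close>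
collects the coefficients that occur at \<open>mon w\<close> in some expression of an element of \<open>M\<close> with largest
exponent \<open>w\<close>; this is the ideal of leading coefficients of the preimage of \<open>M\<close> in the polynomial ring.\<close>

definition low :: "(nat \<Rightarrow> nat) \<Rightarrow> 'a set"
  where "low w = aspan (mon ` {v. lex_less m v w \<and> wt v = wt w})"

definition lead :: "('g \<Rightarrow> 'a set) \<Rightarrow> (nat \<Rightarrow> nat) \<Rightarrow> 'b set"
  where "lead M w = {a \<in> carrier A. \<exists>f \<in> low w. \<phi> a \<otimes> mon w \<oplus> f \<in> M (wt w)}"

lemma low_carrier: "f \<in> low w \<Longrightarrow> f \<in> carrier R"
  unfolding low_def by (erule aspan_carrier) simp

lemma low_submod: "submod (low w)"
  unfolding low_def by (rule aspan_submod) simp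

lemma low_add: "f \<in> low w \<Longrightarrow> mon v \<otimes> f \<in> low (\<lambda>i. w i + v i)"
  unfolding low_def
proof (erule mult_aspan)
  fix b assume "b \<in> mon ` {u. lex_less m u w \<and> wt u = wt w}"
  then obtain u where u: "b = mon u" "lex_less m u w" "wt u = wt w" by auto
  then have "mon v \<otimes> b = mon (\<lambda>i. u i + v i)" by (simp add: mon_add m_comm)
  moreover have "(\<lambda>i. u i + v i) \<in> {va. lex_less m va (\<lambda>i. w i + v i) \<and> wt va = wt (\<lambda>i. w i + v i)}"
    using u by (simp add: lex_less_add wt_add)
  ultimately show "mon v \<otimes> b \<in> aspan (mon ` {va. lex_less m va (\<lambda>i. w i + v i) \<and> wt va = wt (\<lambda>i. w i + v i)})"
    by (intro aspan_incl) auto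
qed simp_all

lemma lead_ideal:
  assumes M: "\<And>\<gamma>. submod (M \<gamma>)"
  shows "ideal (lead M w) A"
proof (rule base.idealI_closed)
  show "lead M w \<subseteq> carrier A" by (auto simp: lead_def)
  show "\<zero>\<^bsub>A\<^esub> \<in> lead M w"
    using submod_zero[OF M] by (auto simp: lead_def intro!: bexI[of _ \<zero>] submod_zero[OF low_submod])
next
  fix a b assume "a \<in> lead M w" "b \<in> lead M w"
  then obtain f f' where ab: "a \<in> carrier A" "b \<in> carrier A" "f \<in> low w" "f' \<in> low w"
    "\<phi> a \<otimes> mon w \<oplus> f \<in> M (wt w)" "\<phi> b \<otimes> mon w \<oplus> f' \<in> M (wt w)" by (auto simp: lead_def)
  have "(\<phi> a \<otimes> mon w \<oplus> f) \<oplus> (\<phi> b \<otimes> mon w \<oplus> f') = \<phi> (a \<oplus>\<^bsub>A\<^esub> b) \<otimes> mon w \<oplus> (f \<oplus> f')"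
    using ab(1-4) low_carrier[of f] low_carrier[of f'] by (simp add: phi_add l_distr a_ac)
  then show "a \<oplus>\<^bsub>A\<^esub> b \<in> lead M w"
    using ab submod_add[OF M ab(5,6)] submod_add[OF low_submod ab(3,4)] by (auto simp: lead_def)
next
  fix r a assume r: "r \<in> carrier A" and "a \<in> lead M w"
  then obtain f where a: "a \<in> carrier A" "f \<in> low w" "\<phi> a \<otimes> mon w \<oplus> f \<in> M (wt w)" by (auto simp: lead_def)
  have "\<phi> r \<otimes> (\<phi> a \<otimes> mon w \<oplus> f) = \<phi> (r \<otimes>\<^bsub>A\<^esub> a) \<otimes> mon w \<oplus> \<phi> r \<otimes> f"
    using a r low_carrier[of f] by (simp add: phi_mult r_distr m_assoc)
  then show "r \<otimes>\<^bsub>A\<^esub> a \<in> lead M w"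
    using a r submod_smult[OF M r a(3)] submod_smult[OF low_submod r a(2)] by (auto simp: lead_def)
qed

lemma lead_mono:
  assumes M: "\<And>\<gamma>. submod (M \<gamma>)"
    and stable: "\<And>\<gamma> v x. x \<in> M \<gamma> \<Longrightarrow> mon v \<otimes> x \<in> M (\<gamma> + wt v)"
    and le: "\<And>i. i < m \<Longrightarrow> w i \<le> w' i"
  shows "lead M w \<subseteq> lead M w'"
proof
  fix a assume "a \<in> lead M w"
  then obtain f where a: "a \<in> carrier A" "f \<in> low w" "\<phi> a \<otimes> mon w \<oplus> f \<in> M (wt w)" by (auto simp: lead_def)
  define v where "v = (\<lambda>i. w' i - w i)"
  have eq: "w i + v i = w' i" if "i < m" for i using le[OF that] by (simp add: v_def)
  have w': "mon w' = mon w \<otimes> mon v" "wt w' = wt w + wt v"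
    using mon_cong[of "\<lambda>i. w i + v i" w'] wt_cong[of "\<lambda>i. w i + v i" w'] eq
    by (auto simp: mon_add wt_add)
  have "low (\<lambda>i. w i + v i) \<subseteq> low w'"
    unfolding low_def using eq w'(2) lex_less_cong[of m _ "\<lambda>i. w i + v i" w']
    by (intro aspan_mono image_mono) (auto simp: wt_add)
  with low_add[OF a(2)] have low: "mon v \<otimes> f \<in> low w'" by blast
  have "mon v \<otimes> (\<phi> a \<otimes> mon w \<oplus> f) = \<phi> a \<otimes> mon w' \<oplus> mon v \<otimes> f"
    using a low_carrier[of f] w' by (simp add: r_distr m_ac)
  then have "\<phi> a \<otimes> mon w' \<oplus> mon v \<otimes> f \<in> M (wt w')"
    using stable[OF a(3), of v] w'(2) by simp
  then show "a \<in> lead M w'" using a low by (auto simp: lead_def)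
qed

definition upto_span :: "(nat \<Rightarrow> nat) \<Rightarrow> 'a set"
  where "upto_span w = aspan (insert (mon w) (mon ` {v. lex_less m v w \<and> wt v = wt w}))"

lemma aspan_mon_subset_upto_span:
  assumes "x \<in> aspan (mon ` W)" "\<And>w. w \<in> W \<Longrightarrow> wt w = \<gamma>"
  shows "x = \<zero> \<or> (\<exists>w\<in>W. x \<in> upto_span w)"
  using assms(1)
proof (induction rule: aspan.induct)
  case (add x y)
  have mono: "upto_span w \<subseteq> upto_span w'" if "w \<in> W" "w' \<in> W" "lex_less m w w' \<or> (\<forall>i<m. w i = w' i)" for w w'
    unfolding upto_span_def
  proof (rule aspan_mono, rule insert_subsetI)
    have wt: "wt w = wt w'" using that assms(2) by simp
    show "mon w \<in> insert (mon w') (mon ` {v. lex_less m v w' \<and> wt v = wt w'})"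
      using that(3) mon_cong[of w w'] wt by auto
    show "mon ` {v. lex_less m v w \<and> wt v = wt w} \<subseteq> insert (mon w') (mon ` {v. lex_less m v w' \<and> wt v = wt w'})"
      using that(3) wt lex_less_trans[of m _ w w'] lex_less_cong[of m _ w w'] by auto
  qed
  have carr: "x \<in> carrier R" "y \<in> carrier R" using add.hyps aspan_carrier by auto
  have sub: "submod (upto_span w)" for w unfolding upto_span_def by (rule aspan_submod) auto
  consider "x = \<zero>" | "y = \<zero>" | w w' where "w \<in> W" "x \<in> upto_span w" "w' \<in> W" "y \<in> upto_span w'"
    using add.IH by blast
  then show ?case
  proof cases
    case 3
    have "lex_less m w w' \<or> (\<forall>i<m. w i = w' i) \<or> lex_less m w' w" using lex_less_linear by blast
    then have "x \<in> upto_span w' \<and> y \<in> upto_span w' \<or> x \<in> upto_span w \<and> y \<in> upto_span w"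
      using 3 mono[of w w'] mono[of w' w] by blast
    then show ?thesis using 3 submod_add[OF sub] by blast
  qed (use add carr in auto)
next
  case (smult a b)
  then obtain w where "w \<in> W" "b = mon w" by auto
  then have "\<phi> a \<otimes> b \<in> upto_span w"
    using smult unfolding upto_span_def by (intro aspan.smult) auto
  with \<open>w \<in> W\<close> show ?case by blast
qed auto

text \<open>The division step of Hilbert's basis theorem: the leading coefficient of an element of \<open>M\<close> also leads
an element of \<open>H\<close>, and their difference has a smaller leading exponent. The lexicographic
order is well-founded, so this stops.\<close>

lemma subset_if_lead_subset:
  assumes M: "\<And>\<gamma>. submod (M \<gamma>)" and H: "\<And>\<gamma>. submod (H \<gamma>)"
    and HM: "\<And>\<gamma>. H \<gamma> \<subseteq> M \<gamma>"
    and M_span: "\<And>\<gamma>. M \<gamma> \<subseteq> aspan (mon ` {w. wt w = \<gamma>})"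
    and lead: "\<And>w. lead M w \<subseteq> lead H w"
  shows "M \<gamma> \<subseteq> H \<gamma>"
proof -
  have claim: "x \<in> H (wt w)" if "x \<in> M (wt w)" "x \<in> upto_span w" for x w
    using that
  proof (induction w arbitrary: x rule: wf_induct_rule[OF wf_lex_less[of m]])
    case (1 w)
    obtain a f where a: "a \<in> carrier A" "f \<in> low w" and x: "x = \<phi> a \<otimes> mon w \<oplus> f"
      using aspan_insert[of x "mon w" "mon ` {v. lex_less m v w \<and> wt v = wt w}"] "1.prems"(2)
      unfolding upto_span_def low_def by auto
    have "a \<in> lead M w" using a x "1.prems"(1) by (auto simp: lead_def)
    then have "a \<in> lead H w" using lead by blast
    then obtain f' where f': "f' \<in> low w" and h: "\<phi> a \<otimes> mon w \<oplus> f' \<in> H (wt w)" by (auto simp: lead_def)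
    define h where "h = \<phi> a \<otimes> mon w \<oplus> f'"
    have carr: "f \<in> carrier R" "f' \<in> carrier R" "\<phi> a \<otimes> mon w \<in> carrier R"
      using a f' low_carrier by auto
    have diff: "x \<ominus> h = f \<ominus> f'"
      using carr unfolding x h_def a_minus_def by (simp add: minus_add a_ac) (simp add: r_neg r_neg1 a_ac)
    have y_low: "x \<ominus> h \<in> low w" unfolding diff using submod_minus[OF low_submod a(2) f'] .
    have hM: "h \<in> M (wt w)" using h HM unfolding h_def by blast
    have y_M: "x \<ominus> h \<in> M (wt w)" using submod_minus[OF M "1.prems"(1) hM] .
    have "x \<ominus> h \<in> H (wt w)"
    proof -
      consider "x \<ominus> h = \<zero>" | v where "lex_less m v w" "wt v = wt w" "x \<ominus> h \<in> upto_span v"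
        using aspan_mon_subset_upto_span[OF y_low[unfolded low_def], of "wt w"] by auto
      then show ?thesis
      proof cases
        case 1
        then show ?thesis using submod_zero[OF H] by simp
      next
        case 2
        then show ?thesis using "1.IH"[of v "x \<ominus> h"] y_M by simp
      qed
    qed
    then have "(x \<ominus> h) \<oplus> h \<in> H (wt w)" using h submod_add[OF H] unfolding h_def by blast
    moreover have "(x \<ominus> h) \<oplus> h = x"
      using submod_carrier[OF M "1.prems"(1)] submod_carrier[OF M hM] by (simp add: a_minus_def a_assoc l_neg)
    ultimately show ?case by simp
  qed
  show ?thesis
  proof
    fix x assume x: "x \<in> M \<gamma>"
    then have "x = \<zero> \<or> (\<exists>w\<in>{w. wt w = \<gamma>}. x \<in> upto_span w)"
      using M_span by (intro aspan_mon_subset_upto_span) auto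
    then show "x \<in> H \<gamma>" using x claim submod_zero[OF H] by auto
  qed
qed

text \<open>With bidegrees as weights this says that a graded submodule of the Rees algebra is finitely generated,
and it uses only that the base ring is Noetherian. The ideal \<open>lead M w\<close> grows with \<open>w\<close>, hence depends only on the truncation of \<open>w\<close> at some \<open>K\<close>.
Lifting finite generating sets of these finitely many ideals to elements of \<open>M\<close> gives elements whose
span has the same leading coefficients as \<open>M\<close>, hence is \<open>M\<close>. The generators are homogeneous for
free, since each is lifted inside one member of the family.\<close>

lemma finitely_generated_family:
  assumes noeth: "noetherian_ring A"
    and M: "\<And>\<gamma>. submod (M \<gamma>)"
    and stable: "\<And>\<gamma> v x. x \<in> M \<gamma> \<Longrightarrow> mon v \<otimes> x \<in> M (\<gamma> + wt v)"
    and M_span: "\<And>\<gamma>. M \<gamma> \<subseteq> aspan (mon ` {w. wt w = \<gamma>})"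
  shows "\<exists>Hs. finite Hs \<and> (\<forall>(\<gamma>, h) \<in> Hs. h \<in> M \<gamma>) \<and>
    (\<forall>\<gamma>. M \<gamma> = aspan {mon v \<otimes> h | v \<gamma>' h. (\<gamma>', h) \<in> Hs \<and> \<gamma>' + wt v = \<gamma>})"
proof -
  interpret noeth: noetherian_ring A by (rule noeth)
  have "\<exists>K. \<forall>w. lead M w = lead M (trunc m K w)"
  proof (rule monotone_family_determined_by_trunc)
    fix C :: "nat \<Rightarrow> 'b set" assume C: "range C \<subseteq> range (lead M)" "incseq C"
    have "subset.chain {I. ideal I A} (range C)"
    proof -
      have "x \<subset> y \<or> x = y \<or> y \<subset> x" if "x \<in> range C" "y \<in> range C" for x y
      proof -
        from that obtain k l where kl: "x = C k" "y = C l" by blast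
        then show ?thesis using incseqD[OF C(2), of k l] incseqD[OF C(2), of l k] nat_le_linear[of k l] by blast
      qed
      moreover have "range C \<subseteq> {I. ideal I A}" using C(1) lead_ideal[of M, OF M] by auto
      ultimately show ?thesis unfolding pred_on.chain_def by blast
    qed
    then have "\<Union>(range C) \<in> range C" by (intro noeth.ideal_chain_is_trivial) auto
    then obtain n where n: "\<Union>(range C) = C n" by auto
    have "C k = C n" if "k \<ge> n" for k
      using incseqD[OF C(2) that] n by blast
    then show "\<exists>n. \<forall>k\<ge>n. C k = C n" by blast
  qed (rule lead_mono[OF M stable])
  then obtain K where K: "\<And>w. lead M w = lead M (trunc m K w)" by blast
  have "\<exists>S. finite S \<and> S \<subseteq> lead M w \<and> lead M w = Idl\<^bsub>A\<^esub> S" for w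
    using noeth.finetely_gen[OF lead_ideal[of M w, OF M]] base.genideal_self by blast
  then obtain S where S: "\<And>w. finite (S w)" "\<And>w. S w \<subseteq> lead M w" "\<And>w. lead M w = Idl\<^bsub>A\<^esub> (S w)"
    by metis
  define f where "f w a = (SOME f. f \<in> low w \<and> \<phi> a \<otimes> mon w \<oplus> f \<in> M (wt w))" for w a
  have f: "f w a \<in> low w \<and> \<phi> a \<otimes> mon w \<oplus> f w a \<in> M (wt w)" if "a \<in> S w" for w a
    unfolding f_def by (rule someI_ex) (use S(2)[of w] that in \<open>auto simp: lead_def\<close>)
  define Hs where "Hs = (\<lambda>(w, a). (wt w, \<phi> a \<otimes> mon w \<oplus> f w a)) ` (SIGMA w : range (trunc m K). S w)"
  have fin: "finite Hs"
    unfolding Hs_def by (intro finite_imageI finite_SigmaI finite_range_trunc S(1))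
  have Hs_M: "h \<in> M \<gamma>" if "(\<gamma>, h) \<in> Hs" for \<gamma> h using that f unfolding Hs_def by auto
  define gens where "gens \<gamma> = {mon v \<otimes> h | v \<gamma>' h. (\<gamma>', h) \<in> Hs \<and> \<gamma>' + wt v = \<gamma>}" for \<gamma>
  have gens_M: "gens \<gamma> \<subseteq> M \<gamma>" for \<gamma> unfolding gens_def using Hs_M stable by auto
  have gens_carrier: "gens \<gamma> \<subseteq> carrier R" for \<gamma> using gens_M submod_carrier[OF M] by blast
  define H where "H \<gamma> = aspan (gens \<gamma>)" for \<gamma>
  have H_sub: "submod (H \<gamma>)" for \<gamma> unfolding H_def by (rule aspan_submod[OF gens_carrier])
  have HM: "H \<gamma> \<subseteq> M \<gamma>" for \<gamma> unfolding H_def by (rule aspan_minimal[OF M gens_M])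
  have H_stable: "mon v \<otimes> x \<in> H (\<gamma> + wt v)" if "x \<in> H \<gamma>" for x v \<gamma>
    using that unfolding H_def
  proof (rule mult_aspan)
    fix b assume "b \<in> gens \<gamma>"
    then obtain u \<gamma>' h where u: "b = mon u \<otimes> h" "(\<gamma>', h) \<in> Hs" "\<gamma>' + wt u = \<gamma>" by (auto simp: gens_def)
    have "h \<in> carrier R" using Hs_M[OF u(2)] submod_carrier[OF M] by blast
    then have "mon v \<otimes> b = mon (\<lambda>i. u i + v i) \<otimes> h" using u(1) by (simp add: mon_add m_ac)
    then have "mon v \<otimes> b \<in> gens (\<gamma> + wt v)"
      unfolding gens_def using u by (auto simp: wt_add add.assoc intro!: exI[of _ "\<lambda>i. u i + v i"])
    then show "mon v \<otimes> b \<in> aspan (gens (\<gamma> + wt v))" using gens_carrier by (intro aspan_incl)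
  qed (use gens_carrier in auto)
  have "lead M w \<subseteq> lead H w" for w
  proof -
    define t where "t = trunc m K w"
    have "S t \<subseteq> lead H t"
    proof
      fix a assume a: "a \<in> S t"
      define h where "h = \<phi> a \<otimes> mon t \<oplus> f t a"
      have "(wt t, h) \<in> Hs" unfolding Hs_def h_def t_def using a[unfolded t_def] by (intro image_eqI[of _ _ "(trunc m K w, a)"]) auto
      moreover have "wt (\<lambda>_. 0) = 0" using wt_add[of "\<lambda>_. 0" "\<lambda>_. 0"] by simp
      moreover have "mon (\<lambda>_. 0) \<otimes> h = h"
        using f[OF a] submod_carrier[OF M, of h "wt t"] by (simp add: mon_def[of "\<lambda>_. 0"] flip: h_def)
      ultimately have "h \<in> gens (wt t)" unfolding gens_def by force
      then have "h \<in> H (wt t)" unfolding H_def using gens_carrier by (intro aspan_incl)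
      then show "a \<in> lead H t" using f[OF a] S(2)[of t] a unfolding h_def lead_def by auto
    qed
    then have "lead M t \<subseteq> lead H t"
      unfolding S(3)[of t] by (intro base.genideal_minimal lead_ideal H_sub)
    moreover have "lead H t \<subseteq> lead H w"
      by (rule lead_mono[OF H_sub H_stable]) (auto simp: t_def trunc_def)
    ultimately show ?thesis using K[of w] by (simp add: t_def)
  qed
  then have "M \<gamma> \<subseteq> H \<gamma>" for \<gamma> by (rule subset_if_lead_subset[OF M H_sub HM M_span])
  with HM have "M \<gamma> = H \<gamma>" for \<gamma> by blast
  with fin Hs_M show ?thesis unfolding H_def gens_def by (intro exI[of _ Hs]) blast
qed

end

section \<open>Homogeneous components\<close>

context graded_ring
begin

lemma G_carrier: "x \<in> G u \<Longrightarrow> x \<in> carrier R"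
  using additive_subgroup.a_subset[OF component] by blast

lemma G_zero: "\<zero> \<in> G u"
  using additive_subgroup.zero_closed[OF component] .

lemma G_add: "x \<in> G u \<Longrightarrow> y \<in> G u \<Longrightarrow> x \<oplus> y \<in> G u"
  using additive_subgroup.a_closed[OF component] .

definition comp :: "nat \<Rightarrow> 'a \<Rightarrow> 'a"
  where "comp u x = (THE f. (\<forall>u. f u \<in> G u) \<and> finite {u. f u \<noteq> \<zero>} \<and> x = (\<Oplus>u\<in>{u. f u \<noteq> \<zero>}. f u)) u"

lemma comp_G: "x \<in> carrier R \<Longrightarrow> comp u x \<in> G u"
  and finite_comp: "x \<in> carrier R \<Longrightarrow> finite {u. comp u x \<noteq> \<zero>}"
  and comp_sum_support: "x \<in> carrier R \<Longrightarrow> x = (\<Oplus>u\<in>{u. comp u x \<noteq> \<zero>}. comp u x)"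
proof -
  assume "x \<in> carrier R"
  from theI'[OF decomp[OF this]]
  have "(\<forall>u. comp u x \<in> G u) \<and> finite {u. comp u x \<noteq> \<zero>} \<and> x = (\<Oplus>u\<in>{u. comp u x \<noteq> \<zero>}. comp u x)"
    unfolding comp_def .
  then show "comp u x \<in> G u" "finite {u. comp u x \<noteq> \<zero>}" "x = (\<Oplus>u\<in>{u. comp u x \<noteq> \<zero>}. comp u x)"
    by blast+
qed

lemma comp_closed [simp]: "x \<in> carrier R \<Longrightarrow> comp u x \<in> carrier R"
  using comp_G G_carrier by blast

lemma comp_eqI:
  assumes "finite U" "\<And>u. u \<in> U \<Longrightarrow> f u \<in> G u" "x = (\<Oplus>u\<in>U. f u)"
  shows "comp v x = (if v \<in> U then f v else \<zero>)"
proof -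
  define f' where "f' = (\<lambda>u. if u \<in> U then f u else \<zero>)"
  have carr: "f \<in> U \<rightarrow> carrier R" "f' \<in> U \<rightarrow> carrier R"
    using G_carrier[OF assms(2)] by (auto simp: f'_def)
  have sub: "{u. f' u \<noteq> \<zero>} \<subseteq> U" by (auto simp: f'_def)
  have "(\<Oplus>u\<in>{u. f' u \<noteq> \<zero>}. f' u) = (\<Oplus>u\<in>U. f u)"
    by (rule add.finprod_mono_neutral_cong_left) (use carr sub assms(1) in \<open>auto simp: f'_def\<close>)
  then have "(\<forall>u. f' u \<in> G u) \<and> finite {u. f' u \<noteq> \<zero>} \<and> x = (\<Oplus>u\<in>{u. f' u \<noteq> \<zero>}. f' u)"
    using assms sub finite_subset G_zero by (auto simp: f'_def)
  moreover have "x \<in> carrier R" unfolding assms(3) using carr(1) by (rule finsum_closed)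
  ultimately have "(THE f. (\<forall>u. f u \<in> G u) \<and> finite {u. f u \<noteq> \<zero>} \<and> x = (\<Oplus>u\<in>{u. f u \<noteq> \<zero>}. f u)) = f'"
    using decomp by (intro the1_equality)
  then show ?thesis unfolding comp_def f'_def by simp
qed

lemma comp_sum:
  assumes "x \<in> carrier R" "finite U" "\<And>u. comp u x \<noteq> \<zero> \<Longrightarrow> u \<in> U"
  shows "x = (\<Oplus>u\<in>U. comp u x)"
proof -
  have "(\<Oplus>u\<in>{u. comp u x \<noteq> \<zero>}. comp u x) = (\<Oplus>u\<in>U. comp u x)"
    by (rule add.finprod_mono_neutral_cong_left) (use assms in auto)
  then show ?thesis using comp_sum_support[OF assms(1)] by simp
qed

lemma comp_homogeneous: "x \<in> G v \<Longrightarrow> comp u x = (if u = v then x else \<zero>)"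
  using comp_eqI[of "{v}" "\<lambda>_. x" x u] G_carrier[of x v] by (simp add: finsum_insert)

lemma comp_zero [simp]: "comp u \<zero> = \<zero>"
  using comp_homogeneous[OF G_zero, of u u] by simp

lemma comp_add:
  assumes "x \<in> carrier R" "y \<in> carrier R"
  shows "comp u (x \<oplus> y) = comp u x \<oplus> comp u y"
proof -
  define U where "U = {u. comp u x \<noteq> \<zero>} \<union> {u. comp u y \<noteq> \<zero>}"
  have U: "finite U" using assms finite_comp by (simp add: U_def)
  have "x \<oplus> y = (\<Oplus>u\<in>U. comp u x) \<oplus> (\<Oplus>u\<in>U. comp u y)"
    using comp_sum[OF assms(1) U] comp_sum[OF assms(2) U] by (simp add: U_def)
  also have "\<dots> = (\<Oplus>u\<in>U. comp u x \<oplus> comp u y)"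
    using assms by (intro finsum_addf[symmetric]) auto
  finally have "comp u (x \<oplus> y) = (if u \<in> U then comp u x \<oplus> comp u y else \<zero>)"
    using U assms by (intro comp_eqI) (auto intro: G_add comp_G)
  then show ?thesis using assms by (auto simp: U_def)
qed

lemma comp_finsum:
  assumes "finite S" "f \<in> S \<rightarrow> carrier R"
  shows "comp u (\<Oplus>i\<in>S. f i) = (\<Oplus>i\<in>S. comp u (f i))"
  using assms by (induction S rule: finite_induct) (auto simp: finsum_insert comp_add Pi_iff)

lemma comp_homogeneous_mult:
  assumes p: "p \<in> G i" and y: "y \<in> carrier R"
  shows "comp u (p \<otimes> y) = (if i \<le> u then p \<otimes> comp (u - i) y else \<zero>)"
proof -
  define U where "U = {u. comp u y \<noteq> \<zero>}"
  have U: "finite U" using y finite_comp by (simp add: U_def)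
  have pc: "p \<in> carrier R" using p G_carrier by blast
  have "p \<otimes> y = p \<otimes> (\<Oplus>k\<in>U. comp k y)" using comp_sum[OF y U] by (simp add: U_def)
  also have "\<dots> = (\<Oplus>k\<in>U. p \<otimes> comp (k + i - i) y)"
    using U pc y by (simp add: finsum_rdistr Pi_iff)
  also have "\<dots> = (\<Oplus>l\<in>(\<lambda>k. k + i) ` U. p \<otimes> comp (l - i) y)"
    using pc y by (intro finsum_reindex[symmetric]) (auto simp: inj_on_def)
  finally have "comp u (p \<otimes> y) = (if u \<in> (\<lambda>k. k + i) ` U then p \<otimes> comp (u - i) y else \<zero>)"
  proof (rule comp_eqI[rotated 2])
    show "p \<otimes> comp (l - i) y \<in> G l" if "l \<in> (\<lambda>k. k + i) ` U" for l
      using that mult_component[OF p comp_G[OF y]] by (auto simp: add.commute)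
  qed (use U in auto)
  moreover have "u - i \<notin> U" if "i \<le> u" "u \<notin> (\<lambda>k. k + i) ` U" using that by force
  ultimately show ?thesis using pc unfolding U_def by auto
qed

lemma comp_mult:
  assumes x: "x \<in> carrier R" and y: "y \<in> carrier R"
  shows "comp u (x \<otimes> y) = (\<Oplus>i\<in>{..u}. comp i x \<otimes> comp (u - i) y)"
proof -
  define U where "U = {u. comp u x \<noteq> \<zero>} \<union> {..u}"
  have U: "finite U" using x finite_comp by (simp add: U_def)
  have "x \<otimes> y = (\<Oplus>i\<in>U. comp i x) \<otimes> y" using comp_sum[OF x U] by (simp add: U_def)
  also have "\<dots> = (\<Oplus>i\<in>U. comp i x \<otimes> y)" using U x y by (simp add: finsum_ldistr Pi_iff)
  finally have "comp u (x \<otimes> y) = (\<Oplus>i\<in>U. comp u (comp i x \<otimes> y))"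
    using U x y by (simp add: comp_finsum Pi_iff)
  also have "\<dots> = (\<Oplus>i\<in>{..u}. comp i x \<otimes> comp (u - i) y)"
    by (rule add.finprod_mono_neutral_cong_right[OF U])
      (use x y in \<open>auto simp: U_def comp_homogeneous_mult[OF comp_G[OF x] y]\<close>)
  finally show ?thesis .
qed

section \<open>Homogeneous witnesses of associated primes\<close>

definition homogeneous_set :: "'a set \<Rightarrow> bool"
  where "homogeneous_set J \<longleftrightarrow> (\<forall>x\<in>J. \<forall>u. comp u x \<in> J)"

lemma ideal_finsum_closed:
  assumes "ideal J R" "finite S" "\<And>i. i \<in> S \<Longrightarrow> f i \<in> J"
  shows "(\<Oplus>i\<in>S. f i) \<in> J"
  using assms(2,3)
proof (induction S rule: finite_induct)
  case empty
  then show ?case using additive_subgroup.zero_closed[OF ideal.axioms(1)[OF assms(1)]] by simp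
next
  case (insert i S)
  have "f \<in> insert i S \<rightarrow> carrier R" using insert.prems ideal.Icarr[OF assms(1)] by auto
  then show ?case using insert additive_subgroup.a_closed[OF ideal.axioms(1)[OF assms(1)]]
    by (simp add: finsum_insert Pi_iff)
qed

text \<open>Induction on the number of components of \<open>f\<close> outside \<open>J\<close>. Suppose that \<open>comp r p\<close> is the highest component of
\<open>p\<close> outside \<open>P\<close> and \<open>comp s f\<close> the highest component of \<open>f\<close> outside \<open>J\<close>. Modulo \<open>J\<close>, the only
contribution to degree \<open>r + s\<close> of \<open>p \<otimes> f \<in> J\<close> is \<open>comp r p \<otimes> comp s f\<close>, which therefore lies in
\<open>J\<close>. Since \<open>P\<close> is prime, \<open>comp r p \<otimes> f\<close> has the same annihilator \<open>P\<close> modulo \<open>J\<close>, but it has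
fewer components outside \<open>J\<close>.\<close>

lemma homogeneous_if_prime_colon:
  assumes J: "ideal J R" "homogeneous_set J" and P: "primeideal P R"
    and f: "f \<in> carrier R" "P = colon R J f" and p: "p \<in> P"
  shows "comp u p \<in> P"
  using f
proof (induction "card {k. comp k f \<notin> J}" arbitrary: f rule: less_induct)
  case less
  interpret P: primeideal P R by (rule P)
  interpret J: ideal J R by (rule J)
  have pc: "p \<in> carrier R" using p P.Icarr by blast
  have finJ: "finite {k. comp k f \<notin> J}"
    by (rule finite_subset[OF _ finite_comp[OF less.prems(1)]]) (use J.zero_closed in auto)
  have mem_P: "x \<in> P \<longleftrightarrow> x \<in> carrier R \<and> x \<otimes> f \<in> J" for x
    by (subst less.prems(2)) (simp add: colon_def)
  show ?case
  proof (rule ccontr)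
    assume "comp u p \<notin> P"
    then have ne_p: "{i. comp i p \<notin> P} \<noteq> {}" by blast
    have fin_p: "finite {i. comp i p \<notin> P}"
      by (rule finite_subset[OF _ finite_comp[OF pc]]) (use P.zero_closed in auto)
    define r where "r = Max {i. comp i p \<notin> P}"
    have r: "comp r p \<notin> P" using Max_in[OF fin_p ne_p] by (simp add: r_def)
    have above_r: "comp i p \<in> P" if "i > r" for i
      using Max_ge[OF fin_p, of i] that by (force simp: r_def)
    have "f \<notin> J"
    proof
      assume "f \<in> J"
      then have "\<one> \<in> P" using mem_P less.prems(1) by simp
      then show False using P.I_notcarr P.one_imp_carrier by simp
    qed
    moreover have "f = (\<Oplus>k\<in>{k. comp k f \<noteq> \<zero>}. comp k f)" using comp_sum_support[OF less.prems(1)] .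
    ultimately have ne_f: "{k. comp k f \<notin> J} \<noteq> {}"
      using ideal_finsum_closed[OF J(1) finite_comp[OF less.prems(1)], of "\<lambda>k. comp k f"] by auto
    define s where "s = Max {k. comp k f \<notin> J}"
    have s: "comp s f \<notin> J" using Max_in[OF finJ ne_f] by (simp add: s_def)
    have above_s: "comp k f \<in> J" if "k > s" for k
      using Max_ge[OF finJ, of k] that by (force simp: s_def)
    define t where "t i = comp i p \<otimes> comp (r + s - i) f" for i
    have tc: "t i \<in> carrier R" for i using pc less.prems(1) by (simp add: t_def)
    have t_J: "t i \<in> J" if "i \<le> r + s" "i \<noteq> r" for i
    proof (cases "i < r")
      case True
      then show ?thesis unfolding t_def using pc above_s by (intro J.I_l_closed) auto
    next
      case False
      then have "comp i p \<otimes> f \<in> J" using above_r[of i] that mem_P by simp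
      then have "comp (r + s) (comp i p \<otimes> f) \<in> J" using J(2) by (simp add: homogeneous_set_def)
      then show ?thesis using that comp_homogeneous_mult[OF comp_G[OF pc] less.prems(1)] by (simp add: t_def)
    qed
    have "p \<otimes> f \<in> J" using p mem_P by blast
    then have "comp (r + s) (p \<otimes> f) \<in> J" using J(2) by (simp add: homogeneous_set_def)
    then have "(\<Oplus>i\<in>{..r + s}. t i) \<in> J" using comp_mult[OF pc less.prems(1)] by (simp add: t_def)
    moreover have "{..r + s} = insert r ({..r + s} - {r})" by auto
    ultimately have all: "t r \<oplus> (\<Oplus>i\<in>{..r + s} - {r}. t i) \<in> J"
      using tc finsum_insert[of "{..r + s} - {r}" r t] by simp
    have rest: "(\<Oplus>i\<in>{..r + s} - {r}. t i) \<in> J"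
      using t_J by (intro ideal_finsum_closed[OF J(1)]) auto
    have "(t r \<oplus> (\<Oplus>i\<in>{..r + s} - {r}. t i)) \<oplus> \<ominus> (\<Oplus>i\<in>{..r + s} - {r}. t i) \<in> J"
      by (rule J.a_closed[OF all J.a_inv_closed[OF rest]])
    then have tr: "t r \<in> J" using tc J.Icarr[OF rest] by (simp add: a_assoc r_neg)
    define f' where "f' = comp r p \<otimes> f"
    have f'c: "f' \<in> carrier R" using pc less.prems(1) by (simp add: f'_def)
    have "P = colon R J f'"
    proof -
      have "x \<otimes> f' \<in> J \<longleftrightarrow> x \<in> P" if "x \<in> carrier R" for x
      proof -
        have "x \<otimes> f' = (x \<otimes> comp r p) \<otimes> f" using that pc less.prems(1) by (simp add: f'_def m_assoc)
        then have "x \<otimes> f' \<in> J \<longleftrightarrow> x \<otimes> comp r p \<in> P" using mem_P[of "x \<otimes> comp r p"] that pc by simp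
        also have "\<dots> \<longleftrightarrow> x \<in> P" using P.I_prime[of x "comp r p"] r that pc P.I_r_closed by auto
        finally show ?thesis .
      qed
      then show ?thesis using P.Icarr by (auto simp: colon_def)
    qed
    moreover have "card {k. comp k f' \<notin> J} < card {k. comp k f \<notin> J}"
    proof -
      have "{k. comp k f' \<notin> J} \<subseteq> (\<lambda>k. k + r) ` ({k. comp k f \<notin> J} - {s})"
      proof
        fix k assume "k \<in> {k. comp k f' \<notin> J}"
        then have "comp k f' \<notin> J" by simp
        then have k: "r \<le> k" "comp r p \<otimes> comp (k - r) f \<notin> J"
          using comp_homogeneous_mult[OF comp_G[OF pc, of r] less.prems(1), of k] J.zero_closed
          by (auto simp: f'_def split: if_splits)
        have "k - r \<noteq> s" using k(2) tr by (auto simp: t_def)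
        moreover have "comp (k - r) f \<notin> J" using k(2) J.I_l_closed pc by auto
        ultimately show "k \<in> (\<lambda>k. k + r) ` ({k. comp k f \<notin> J} - {s})"
          using k(1) by (intro image_eqI[of _ _ "k - r"]) auto
      qed
      then have "card {k. comp k f' \<notin> J} \<le> card ((\<lambda>k. k + r) ` ({k. comp k f \<notin> J} - {s}))"
        using finJ by (intro card_mono) auto
      also have "\<dots> \<le> card ({k. comp k f \<notin> J} - {s})" using finJ by (intro card_image_le) auto
      also have "\<dots> < card {k. comp k f \<notin> J}" using finJ s by (intro card_Diff1_less) auto
      finally show ?thesis .
    qed
    ultimately have "comp u p \<in> P" using less.hyps f'c by blast
    with \<open>comp u p \<notin> P\<close> show False by blast
  qed
qed

text \<open>Makes the minimum defining the \<open>v\<close>-invariant one over a nonempty set. As \<open>P\<close> is homogeneous, it kills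
every component of a witness \<open>f\<close> modulo \<open>J\<close>. If each component were killed by something outside \<open>P\<close>, then the
product of these finitely many multipliers would kill \<open>f\<close> and still lie outside \<open>P\<close>.\<close>

lemma ass_quot_homogeneous_witness:
  assumes J: "ideal J R" "homogeneous_set J" and P: "P \<in> ass_quot R J"
  shows "\<exists>u. \<exists>h \<in> G u. P = colon R J h"
proof -
  obtain f where prime: "primeideal P R" and f: "f \<in> carrier R" "P = colon R J f"
    using P by (auto simp: ass_quot_def)
  interpret P: primeideal P R by (rule prime)
  interpret J: ideal J R by (rule J)
  have mem_P: "x \<in> P \<longleftrightarrow> x \<in> carrier R \<and> x \<otimes> f \<in> J" for x
    by (subst f(2)) (simp add: colon_def)
  have sub: "P \<subseteq> colon R J (comp k f)" for k
  proof
    fix p assume p: "p \<in> P"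
    then have pc: "p \<in> carrier R" using P.Icarr by blast
    have "comp i p \<otimes> comp k f \<in> J" for i
    proof -
      have "comp i p \<in> P" using homogeneous_if_prime_colon[OF J prime f p] .
      then have "comp i p \<otimes> f \<in> J" using mem_P by blast
      then have "comp (i + k) (comp i p \<otimes> f) \<in> J" using J(2) by (simp add: homogeneous_set_def)
      then show ?thesis using comp_homogeneous_mult[OF comp_G[OF pc] f(1)] by simp
    qed
    then have "(\<Oplus>i\<in>{i. comp i p \<noteq> \<zero>}. comp i p \<otimes> comp k f) \<in> J"
      by (intro ideal_finsum_closed[OF J(1) finite_comp[OF pc]])
    moreover have "p \<otimes> comp k f = (\<Oplus>i\<in>{i. comp i p \<noteq> \<zero>}. comp i p) \<otimes> comp k f"
      using comp_sum_support[OF pc] by simp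
    then have "p \<otimes> comp k f = (\<Oplus>i\<in>{i. comp i p \<noteq> \<zero>}. comp i p \<otimes> comp k f)"
      using finite_comp[OF pc] pc f(1) by (simp add: finsum_ldistr Pi_iff)
    ultimately show "p \<in> colon R J (comp k f)" using pc by (simp add: colon_def)
  qed
  have "\<exists>k. colon R J (comp k f) \<subseteq> P"
  proof (rule ccontr)
    assume *: "\<nexists>k. colon R J (comp k f) \<subseteq> P"
    have "\<exists>s\<in>carrier R - P. \<forall>k\<in>U. s \<otimes> comp k f \<in> J" if "finite U" for U
      using that
    proof (induction U rule: finite_induct)
      case empty
      have "\<one> \<notin> P" using P.I_notcarr P.one_imp_carrier by auto
      then show ?case by auto
    next
      case (insert k U)
      then obtain s where s: "s \<in> carrier R - P" "\<forall>k\<in>U. s \<otimes> comp k f \<in> J" by blast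
      obtain s' where s': "s' \<in> carrier R" "s' \<notin> P" "s' \<otimes> comp k f \<in> J"
        using * by (auto simp: colon_def)
      have "s \<otimes> s' \<notin> P" using s s' P.I_prime by auto
      moreover have "(s \<otimes> s') \<otimes> comp l f \<in> J" if "l \<in> insert k U" for l
      proof (cases "l = k")
        case True
        have "(s \<otimes> s') \<otimes> comp k f = s \<otimes> (s' \<otimes> comp k f)" using s s' f(1) by (simp add: m_assoc)
        then show ?thesis using True s s' J.I_l_closed by auto
      next
        case False
        have "(s \<otimes> s') \<otimes> comp l f = s' \<otimes> (s \<otimes> comp l f)" using s s' f(1) by (simp add: m_ac)
        then show ?thesis using False that s s' J.I_l_closed by auto
      qed
      ultimately show ?case using s s' by (intro bexI[of _ "s \<otimes> s'"]) auto
    qed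
    from this[OF finite_comp[OF f(1)]]
    obtain s where s: "s \<in> carrier R" "s \<notin> P" "\<And>k. comp k f \<noteq> \<zero> \<Longrightarrow> s \<otimes> comp k f \<in> J" by auto
    have "s \<otimes> f = s \<otimes> (\<Oplus>k\<in>{k. comp k f \<noteq> \<zero>}. comp k f)" using comp_sum_support[OF f(1)] by simp
    also have "\<dots> = (\<Oplus>k\<in>{k. comp k f \<noteq> \<zero>}. s \<otimes> comp k f)"
      using finite_comp[OF f(1)] s f(1) by (simp add: finsum_rdistr Pi_iff)
    also have "\<dots> \<in> J" using s(3) by (intro ideal_finsum_closed[OF J(1) finite_comp[OF f(1)]]) auto
    finally show False using s(1,2) mem_P by blast
  qed
  then show ?thesis using sub comp_G[OF f(1)] by blast
qed

end

section \<open>Powers of the ideal as spans of monomials\<close>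

text \<open>One list of variables serves the ring and the ideal: \<open>\<eta> i = 1\<close> marks the generators of \<open>I\<close>, and
\<open>\<eta> i = 0\<close> the remaining generators of \<open>R\<close> as an algebra. A monomial of weight \<open>(u, n)\<close> is thus
homogeneous of degree \<open>u\<close> and visibly in the \<open>n\<close>-th power of \<open>I\<close>.\<close>

locale homogeneous_generators = graded_ring R G + algebra_map A R \<phi>
  for A :: "('b, 'n) ring_scheme" and R :: "('a, 'm) ring_scheme" (structure) and G \<phi> +
  fixes m :: nat and z :: "nat \<Rightarrow> 'a" and \<delta> \<eta> :: "nat \<Rightarrow> nat" and I :: "'a set"
  assumes base_degree_zero: "\<phi> ` carrier A \<subseteq> G 0"
    and z_G: "i < m \<Longrightarrow> z i \<in> G (\<delta> i)"
    and eta_le: "i < m \<Longrightarrow> \<eta> i \<le> 1"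
    and ring_generators: "generate_ring R (\<phi> ` carrier A \<union> z ` {i. i < m \<and> \<eta> i = 0}) = carrier R"
    and ideal_generators: "I = Idl (z ` {i. i < m \<and> \<eta> i = 1})"
begin

definition wt :: "(nat \<Rightarrow> nat) \<Rightarrow> nat \<times> nat"
  where "wt w = (\<Sum>i<m. \<delta> i * w i, \<Sum>i<m. \<eta> i * w i)"

sublocale weighted_monomials A R \<phi> m z wt
proof
  show "z i \<in> carrier R" if "i < m" for i using z_G[OF that] by (rule G_carrier)
  show "wt (\<lambda>i. w i + v i) = wt w + wt v" for w v
    by (simp add: wt_def plus_prod_def sum.distrib algebra_simps)
  show "wt w = wt v" if "\<And>i. i < m \<Longrightarrow> w i = v i" for w v
    using that by (simp add: wt_def)
qed

lemma mon_in_multiplicative_family: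
  assumes F: "\<And>u. F u \<subseteq> carrier R" "\<one> \<in> F 0"
    and mult: "\<And>u v x y. x \<in> F u \<Longrightarrow> y \<in> F v \<Longrightarrow> x \<otimes> y \<in> F (u + v)"
    and z: "\<And>i. i < m \<Longrightarrow> z i \<in> F (\<kappa> i)"
  shows "mon w \<in> F (\<Sum>i<m. \<kappa> i * w i)"
proof -
  have pow: "z i [^] k \<in> F (\<kappa> i * k)" if i: "i < m" for i and k :: nat
  proof (induction k)
    case (Suc k)
    then show ?case using mult[OF Suc z[OF i]] by (simp add: add.commute)
  qed (simp add: F)
  have "(\<Otimes>i\<in>{..<k}. z i [^] w i) \<in> F (\<Sum>i<k. \<kappa> i * w i)" if "k \<le> m" for k
    using that
  proof (induction k)
    case (Suc k)
    have "(\<Otimes>i\<in>insert k {..<k}. z i [^] w i) = z k [^] w k \<otimes> (\<Otimes>i\<in>{..<k}. z i [^] w i)"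
      using Suc.prems z_closed by (intro finprod_insert) auto
    then show ?case using mult[OF pow[of k "w k"]] Suc by (simp add: lessThan_Suc)
  qed (simp add: F)
  then show ?thesis by (simp add: mon_def)
qed

lemma one_G: "\<one> \<in> G 0"
  using base_degree_zero phi_one base.one_closed by (metis image_subset_iff)

lemma phi_G: "a \<in> carrier A \<Longrightarrow> \<phi> a \<in> G 0"
  using base_degree_zero by blast

lemma mon_G: "mon w \<in> G (fst (wt w))"
  unfolding wt_def fst_conv
  by (rule mon_in_multiplicative_family) (use G_carrier one_G mult_component z_G in auto)

lemma mon_zero: "mon (\<lambda>_. 0) = \<one>"
  by (simp add: mon_def)

lemma mon_unit: "i < m \<Longrightarrow> mon (\<lambda>j. if j = i then 1 else 0) = z i"
proof -
  assume i: "i < m"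
  have "mon (\<lambda>j. if j = i then 1 else 0) = (\<Otimes>j\<in>{..<m}. if i = j then z j else \<one>)"
    unfolding mon_def using z_closed by (intro finprod_cong') auto
  also have "\<dots> = z i" using i z_closed by (intro finprod_singleton) auto
  finally show ?thesis .
qed

lemma wt_unit: "i < m \<Longrightarrow> wt (\<lambda>j. if j = i then 1 else 0) = (\<delta> i, \<eta> i)"
  by (simp add: wt_def if_distrib[of "(*) _"] cong: if_cong)

definition power_span :: "nat \<Rightarrow> 'a set"
  where "power_span n = aspan (mon ` {w. snd (wt w) = n})"

lemma power_span_submod: "submod (power_span n)"
  unfolding power_span_def by (rule aspan_submod) simp

lemma power_span_mult: "x \<in> power_span n \<Longrightarrow> y \<in> power_span k \<Longrightarrow> x \<otimes> y \<in> power_span (n + k)"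
  unfolding power_span_def
proof (erule aspan_mult_aspan, assumption)
  fix b b' assume "b \<in> mon ` {w. snd (wt w) = n}" "b' \<in> mon ` {w. snd (wt w) = k}"
  then obtain w w' where w: "b = mon w" "b' = mon w'" "snd (wt w) = n" "snd (wt w') = k" by auto
  then have "b \<otimes> b' = mon (\<lambda>i. w i + w' i)" "snd (wt (\<lambda>i. w i + w' i)) = n + k"
    by (simp_all add: mon_add wt_add)
  then show "b \<otimes> b' \<in> aspan (mon ` {w. snd (wt w) = n + k})" by (intro aspan_incl) auto
qed simp_all

lemma z_power_span: "i < m \<Longrightarrow> z i \<in> power_span (\<eta> i)"
  using mon_unit[of i] wt_unit[of i] unfolding power_span_def
  by (intro aspan_incl image_eqI[of _ _ "\<lambda>j. if j = i then 1 else 0"]) auto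

lemma power_span_zero: "power_span 0 = carrier R"
proof
  show "power_span 0 \<subseteq> carrier R" using submod_carrier[OF power_span_submod] by blast
  have one: "\<one> \<in> power_span 0"
    unfolding power_span_def by (intro aspan_incl image_eqI[of _ _ "\<lambda>_. 0"]) (auto simp: mon_zero wt_def)
  have "x \<in> power_span 0" if "x \<in> generate_ring R (\<phi> ` carrier A \<union> z ` {i. i < m \<and> \<eta> i = 0})" for x
    using that
  proof (induction rule: generate_ring.induct)
    case (incl h)
    then consider a where "a \<in> carrier A" "h = \<phi> a" | i where "i < m" "\<eta> i = 0" "h = z i" by auto
    then show ?case
    proof cases
      case 1
      then show ?thesis using submod_smult[OF power_span_submod 1(1) one] by simp
    next
      case 2
      then show ?thesis using z_power_span[of i] by simp
    qed
  next
    case (a_inv h)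
    then show ?case using submod_minus[OF power_span_submod submod_zero[OF power_span_submod] a_inv.IH]
      submod_carrier[OF power_span_submod a_inv.IH] by (simp add: a_minus_def)
  next
    case (eng_add h1 h2)
    then show ?case using submod_add[OF power_span_submod] by blast
  next
    case (eng_mult h1 h2)
    then show ?case using power_span_mult[of h1 0 h2 0] by simp
  qed (rule one)
  then show "carrier R \<subseteq> power_span 0" unfolding ring_generators by blast
qed

lemma power_span_ideal: "ideal (power_span n) R"
proof (rule idealI_closed)
  show "r \<otimes> x \<in> power_span n" if "r \<in> carrier R" "x \<in> power_span n" for r x
    using power_span_mult[of r 0 x n] that power_span_zero by simp
qed (use power_span_submod in \<open>auto simp: submod_def\<close>)

lemma I_ideal: "ideal I R"
  unfolding ideal_generators using z_closed by (intro genideal_ideal) auto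

lemma ideal_pow_zero: "ideal_pow R I 0 = carrier R"
  by (simp add: ideals_set_def)

lemma ideal_pow_Suc: "ideal_pow R I (Suc n) = ideal_prod R (ideal_pow R I n) I"
  by (simp add: ideals_set_def)

lemma ideal_pow_ideal: "ideal (ideal_pow R I n) R"
proof (induction n)
  case 0
  show ?case unfolding ideal_pow_zero by (rule oneideal)
next
  case (Suc n)
  show ?case unfolding ideal_pow_Suc by (rule ideal_prod_is_ideal[OF Suc I_ideal])
qed

lemma ideal_pow_mult:
  assumes "x \<in> ideal_pow R I n" "y \<in> ideal_pow R I k"
  shows "x \<otimes> y \<in> ideal_pow R I (n + k)"
proof -
  interpret ideals: comm_monoid "ideals_set R" by (rule ideals_set_is_comm_monoid)
  have "I \<in> carrier (ideals_set R)" using I_ideal by (simp add: ideals_set_def)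
  then have "ideal_pow R I n \<otimes>\<^bsub>ideals_set R\<^esub> ideal_pow R I k = ideal_pow R I (n + k)"
    by (rule ideals.nat_pow_mult)
  then have "ideal_prod R (ideal_pow R I n) (ideal_pow R I k) = ideal_pow R I (n + k)"
    by (simp add: ideals_set_def)
  then show ?thesis using ideal_prod.prod[OF assms] by metis
qed

lemma ideal_pow_one: "ideal_pow R I 1 = I"
proof -
  interpret ideals: comm_monoid "ideals_set R" by (rule ideals_set_is_comm_monoid)
  have "I \<in> carrier (ideals_set R)" using I_ideal by (simp add: ideals_set_def)
  then show ?thesis by (simp only: ideals.nat_pow_eone)
qed

lemma mon_ideal_pow: "mon w \<in> ideal_pow R I (snd (wt w))"
  unfolding wt_def snd_conv
proof (rule mon_in_multiplicative_family)
  show "ideal_pow R I u \<subseteq> carrier R" for u using ideal.Icarr[OF ideal_pow_ideal] by blast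
  show "\<one> \<in> ideal_pow R I 0" by (simp only: ideal_pow_zero one_closed)
  fix i assume i: "i < m"
  consider "\<eta> i = 0" | "\<eta> i = 1" using eta_le[OF i] by linarith
  then show "z i \<in> ideal_pow R I (\<eta> i)"
  proof cases
    case 1
    then show ?thesis using z_closed[OF i] ideal_pow_zero by simp
  next
    case 2
    then have "z i \<in> I" unfolding ideal_generators using i z_closed
      by (intro subsetD[OF genideal_self]) auto
    then show ?thesis using 2 ideal_pow_one by simp
  qed
qed (rule ideal_pow_mult)

lemma ideal_pow_eq_power_span: "ideal_pow R I n = power_span n"
proof
  show "power_span n \<subseteq> ideal_pow R I n"
    unfolding power_span_def
  proof (rule aspan_minimal)
    interpret J: ideal "ideal_pow R I n" R by (rule ideal_pow_ideal)
    show "submod (ideal_pow R I n)"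
      by (rule submodI) (use J.Icarr J.I_l_closed J.zero_closed J.a_closed in auto)
    show "mon ` {w. snd (wt w) = n} \<subseteq> ideal_pow R I n" using mon_ideal_pow by auto
  qed
  show "ideal_pow R I n \<subseteq> power_span n"
  proof (induction n)
    case 0
    show ?case unfolding ideal_pow_zero power_span_zero ..
  next
    case (Suc n)
    have "I \<subseteq> power_span 1"
      unfolding ideal_generators
    proof (intro genideal_minimal power_span_ideal subsetI)
      fix y assume "y \<in> z ` {i. i < m \<and> \<eta> i = 1}"
      then obtain i where "i < m" "\<eta> i = 1" "y = z i" by auto
      then show "y \<in> power_span 1" using z_power_span[of i] by simp
    qed
    show ?case
    proof
      fix x assume "x \<in> ideal_pow R I (Suc n)"
      then have "x \<in> ideal_prod R (ideal_pow R I n) I" by (simp only: ideal_pow_Suc)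
      then show "x \<in> power_span (Suc n)"
      proof (induction rule: ideal_prod.induct)
        case (prod i j)
        then show ?case using power_span_mult[of i n j 1] Suc \<open>I \<subseteq> power_span 1\<close> by auto
      next
        case (sum s1 s2)
        then show ?case using submod_add[OF power_span_submod] by blast
      qed
    qed
  qed
qed

lemma comp_aspan_mon:
  assumes "x \<in> aspan (mon ` W)"
  shows "comp u x \<in> aspan (mon ` {w \<in> W. fst (wt w) = u})"
  using assms
proof (induction rule: aspan.induct)
  case zero
  then show ?case by (simp add: aspan.zero)
next
  case (add x y)
  then show ?case using aspan_carrier[OF _ mon_subset] by (simp add: comp_add aspan.add)
next
  case (smult a b)
  then obtain w where w: "w \<in> W" "b = mon w" by auto
  have "\<phi> a \<otimes> b \<in> G (0 + fst (wt w))"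
    unfolding w(2) by (rule mult_component[OF phi_G[OF smult(1)] mon_G])
  then have "comp u (\<phi> a \<otimes> b) = (if u = fst (wt w) then \<phi> a \<otimes> b else \<zero>)"
    by (simp add: comp_homogeneous)
  then show ?case using smult w by (auto intro: aspan.zero aspan.smult)
qed

lemma ideal_pow_homogeneous: "homogeneous_set (ideal_pow R I n)"
  unfolding homogeneous_set_def
proof (intro ballI allI)
  fix x u assume "x \<in> ideal_pow R I n"
  then have "comp u x \<in> aspan (mon ` {w \<in> {w. snd (wt w) = n}. fst (wt w) = u})"
    unfolding ideal_pow_eq_power_span power_span_def by (rule comp_aspan_mon)
  also have "\<dots> \<subseteq> aspan (mon ` {w. snd (wt w) = n})" by (intro aspan_mono image_mono) blast
  finally show "comp u x \<in> ideal_pow R I n" unfolding ideal_pow_eq_power_span power_span_def .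
qed

text \<open>Taking the component of degree \<open>u\<close> of an \<open>A\<close>-linear combination of monomials only drops the
monomials of other degrees.\<close>

lemma ideal_pow_G_span:
  assumes "x \<in> ideal_pow R I n" "x \<in> G u"
  shows "x \<in> aspan (mon ` {w. wt w = (u, n)})"
proof -
  have "x \<in> aspan (mon ` {w. snd (wt w) = n})"
    using assms(1) unfolding ideal_pow_eq_power_span power_span_def .
  from comp_aspan_mon[OF this, of u]
  have "x \<in> aspan (mon ` {w \<in> {w. snd (wt w) = n}. fst (wt w) = u})"
    using comp_homogeneous[OF assms(2), of u] by simp
  moreover have "{w \<in> {w. snd (wt w) = n}. fst (wt w) = u} = {w. wt w = (u, n)}"
    by (auto simp: prod_eq_iff)
  ultimately show ?thesis by simp
qed

section \<open>Eventual linearity of the v-invariant\<close>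

definition killed :: "'a set \<Rightarrow> nat \<Rightarrow> 'a set"
  where "killed P n = {f \<in> carrier R. \<forall>p\<in>P. p \<otimes> f \<in> ideal_pow R I n}"

text \<open>The elements that vanish in the localization of \<open>R / I^n\<close> at \<open>P\<close>.\<close>

definition locally_zero :: "'a set \<Rightarrow> nat \<Rightarrow> 'a set"
  where "locally_zero P n = {f \<in> carrier R. \<exists>s\<in>carrier R - P. s \<otimes> f \<in> ideal_pow R I n}"

text \<open>For elements killed by \<open>P\<close> modulo \<open>I^n\<close>, having annihilator exactly \<open>P\<close> means surviving in the localization
at \<open>P\<close>. This turns the condition \<open>P = I^n : f\<close> into membership in a difference of two submodules that
are stable under multiplication by monomials.\<close>

lemma eq_colon_iff:
  assumes "P \<subseteq> carrier R" "f \<in> carrier R"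
  shows "P = colon R (ideal_pow R I n) f \<longleftrightarrow> f \<in> killed P n \<and> f \<notin> locally_zero P n"
  using assms unfolding killed_def locally_zero_def colon_def by (simp, blast)

lemma killed_submod:
  assumes "P \<subseteq> carrier R"
  shows "submod (killed P n)"
proof (rule submodI)
  interpret J: ideal "ideal_pow R I n" R by (rule ideal_pow_ideal)
  show "\<zero> \<in> killed P n" using assms J.zero_closed by (auto simp: killed_def subset_iff)
  show "x \<oplus> y \<in> killed P n" if "x \<in> killed P n" "y \<in> killed P n" for x y
    using that assms J.a_closed by (auto simp: killed_def r_distr subset_iff)
  show "\<phi> a \<otimes> x \<in> killed P n" if "a \<in> carrier A" "x \<in> killed P n" for a x
  proof -
    have "p \<otimes> (\<phi> a \<otimes> x) \<in> ideal_pow R I n" if p: "p \<in> P" for p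
    proof -
      have "p \<otimes> (\<phi> a \<otimes> x) = \<phi> a \<otimes> (p \<otimes> x)"
        using that \<open>a \<in> carrier A\<close> \<open>x \<in> killed P n\<close> assms by (auto simp: killed_def m_lcomm subset_iff)
      then show ?thesis using p that \<open>a \<in> carrier A\<close> \<open>x \<in> killed P n\<close> J.I_l_closed by (simp add: killed_def)
    qed
    then show ?thesis using that by (simp add: killed_def)
  qed
qed (auto simp: killed_def)

lemma killed_stable:
  assumes P: "P \<subseteq> carrier R" and f: "f \<in> killed P n"
  shows "mon v \<otimes> f \<in> killed P (n + snd (wt v))"
proof -
  have "p \<otimes> (mon v \<otimes> f) \<in> ideal_pow R I (n + snd (wt v))" if p: "p \<in> P" for p
  proof -
    have "p \<otimes> (mon v \<otimes> f) = (p \<otimes> f) \<otimes> mon v"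
      using p P f by (auto simp: killed_def m_ac subset_iff)
    moreover have "p \<otimes> f \<in> ideal_pow R I n" using p f by (simp add: killed_def)
    ultimately show ?thesis using ideal_pow_mult mon_ideal_pow by metis
  qed
  then show ?thesis using f by (simp add: killed_def)
qed

lemma locally_zero_submod:
  assumes "primeideal P R"
  shows "submod (locally_zero P n)"
proof (rule submodI)
  interpret P: primeideal P R by (rule assms)
  interpret J: ideal "ideal_pow R I n" R by (rule ideal_pow_ideal)
  have one: "\<one> \<in> carrier R - P" using P.I_notcarr P.one_imp_carrier by auto
  show "locally_zero P n \<subseteq> carrier R" by (auto simp: locally_zero_def)
  show "\<zero> \<in> locally_zero P n"
    using one J.zero_closed unfolding locally_zero_def by (auto intro!: bexI[of _ \<one>])
  show "x \<oplus> y \<in> locally_zero P n" if "x \<in> locally_zero P n" "y \<in> locally_zero P n" for x y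
  proof -
    from that obtain s t where st: "x \<in> carrier R" "y \<in> carrier R" "s \<in> carrier R - P" "t \<in> carrier R - P"
      "s \<otimes> x \<in> ideal_pow R I n" "t \<otimes> y \<in> ideal_pow R I n" by (auto simp: locally_zero_def)
    have "(s \<otimes> t) \<otimes> (x \<oplus> y) = t \<otimes> (s \<otimes> x) \<oplus> s \<otimes> (t \<otimes> y)"
      using st by (simp add: r_distr m_ac)
    then have "(s \<otimes> t) \<otimes> (x \<oplus> y) \<in> ideal_pow R I n"
      using st J.I_l_closed J.a_closed by simp
    moreover have "s \<otimes> t \<in> carrier R - P" using st P.I_prime by auto
    ultimately show ?thesis using st unfolding locally_zero_def by blast
  qed
  show "\<phi> a \<otimes> x \<in> locally_zero P n" if "a \<in> carrier A" "x \<in> locally_zero P n" for a x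
  proof -
    from that obtain s where s: "x \<in> carrier R" "s \<in> carrier R - P" "s \<otimes> x \<in> ideal_pow R I n"
      by (auto simp: locally_zero_def)
    have "s \<otimes> (\<phi> a \<otimes> x) = \<phi> a \<otimes> (s \<otimes> x)" using s that by (auto simp: m_lcomm)
    then have "s \<otimes> (\<phi> a \<otimes> x) \<in> ideal_pow R I n" using s that J.I_l_closed by simp
    then show ?thesis using s that unfolding locally_zero_def by auto
  qed
qed

lemma locally_zero_stable:
  assumes f: "f \<in> locally_zero P n"
  shows "mon v \<otimes> f \<in> locally_zero P (n + snd (wt v))"
proof -
  obtain s where s: "f \<in> carrier R" "s \<in> carrier R - P" "s \<otimes> f \<in> ideal_pow R I n"
    using f by (auto simp: locally_zero_def)
  have "s \<otimes> (mon v \<otimes> f) = (s \<otimes> f) \<otimes> mon v" using s by (auto simp: m_ac)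
  then have "s \<otimes> (mon v \<otimes> f) \<in> ideal_pow R I (n + snd (wt v))"
    using ideal_pow_mult[OF s(3) mon_ideal_pow] by simp
  then show ?thesis using s unfolding locally_zero_def by auto
qed

text \<open>The submodules \<open>I^n : P\<close> need not lie in the Rees algebra, but after multiplication by a nonzero
homogeneous \<open>x \<in> P\<close> they do, and in a domain nothing is lost by this. A generator of \<open>I\<close> serves
as \<open>x\<close>, since a prime ideal containing a power of \<open>I\<close> contains \<open>I\<close>.\<close>

lemma v_inv_eventually_linear:
  assumes noeth: "noetherian_ring A" and dom: "domain R"
    and I_ne: "I \<noteq> {\<zero>}" and P: "P \<in> asymptotic_ass R I"
  shows "\<exists>i<m. \<eta> i = 1 \<and> (\<exists>(b :: int) n\<^sub>0. \<forall>n\<ge>n\<^sub>0.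
    int (v_inv R G P (ideal_pow R I n)) = int (\<delta> i) * int n + b)"
proof -
  interpret domain R by (rule dom)
  obtain N where N: "\<And>n. n \<ge> N \<Longrightarrow> P \<in> ass_quot R (ideal_pow R I n)"
    using P by (auto simp: asymptotic_ass_def)
  have prime: "primeideal P R" using N[of N] by (simp add: ass_quot_def)
  interpret P: primeideal P R by (rule prime)
  have P_sub: "P \<subseteq> carrier R" using P.Icarr by blast
  have pow_P: "ideal_pow R I N \<subseteq> P"
  proof
    interpret J: ideal "ideal_pow R I N" R by (rule ideal_pow_ideal)
    obtain f where "f \<in> carrier R" "P = colon R (ideal_pow R I N) f"
      using N[of N] by (auto simp: ass_quot_def)
    moreover fix x assume "x \<in> ideal_pow R I N"
    ultimately show "x \<in> P" using J.I_r_closed J.Icarr by (metis (mono_tags, lifting) colon_def mem_Collect_eq)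
  qed
  obtain i\<^sub>0 where i0: "i\<^sub>0 < m" "\<eta> i\<^sub>0 = 1" "z i\<^sub>0 \<noteq> \<zero>"
  proof (rule ccontr)
    assume "\<not> thesis"
    with that have "z ` {i. i < m \<and> \<eta> i = 1} \<subseteq> {\<zero>}" by blast
    then have "I \<subseteq> {\<zero>}" unfolding ideal_generators by (intro genideal_minimal zeroideal)
    moreover have "\<zero> \<in> I" using additive_subgroup.zero_closed[OF ideal.axioms(1)[OF I_ideal]] .
    ultimately show False using I_ne by blast
  qed
  define x where "x = z i\<^sub>0"
  define e where "e = \<delta> i\<^sub>0"
  have x: "x \<in> carrier R" "x \<noteq> \<zero>" "x \<in> G e"
    using i0 z_closed z_G by (auto simp: x_def e_def)
  have "x \<in> P"
  proof -
    have "mon (\<lambda>j. if j = i\<^sub>0 then 1 else 0) \<in> ideal_pow R I 1"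
      using mon_ideal_pow[of "\<lambda>j. if j = i\<^sub>0 then 1 else 0"] i0(2) unfolding wt_unit[OF i0(1)] by simp
    then have x1: "x \<in> ideal_pow R I 1" unfolding mon_unit[OF i0(1)] x_def .
    have "x [^] k \<in> ideal_pow R I k" for k :: nat
    proof (induction k)
      case 0
      show ?case using ideal_pow_zero by simp
    next
      case (Suc k)
      show ?case using ideal_pow_mult[OF Suc x1] by simp
    qed
    then have "x [^] N \<in> P" using pow_P by blast
    moreover have "x \<in> P" if "x [^] k \<in> P" for k :: nat
      using that
    proof (induction k)
      case 0
      then show ?case using P.I_notcarr P.one_imp_carrier by simp
    next
      case (Suc k)
      then show ?case using P.I_prime[of "x [^] k" x] x(1) by auto
    qed
    ultimately show ?thesis by blast
  qed
  \<comment> \<open>The elements of \<open>I^n : P\<close> of degree \<open>u - e\<close>, indexed by \<open>(u, n)\<close> so that \<open>x\<close> of degree \<open>e\<close> carries them into bidegree \<open>(u, n)\<close>; for \<open>u < e\<close> the member is zero, as the truncated \<open>u - e\<close> would otherwise admit elements of degree zero.\<close>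
  define src where "src \<gamma> = {f \<in> killed P (snd \<gamma>). if e \<le> fst \<gamma> then f \<in> G (fst \<gamma> - e) else f = \<zero>}" for \<gamma>
  define M where "M \<gamma> = (\<lambda>f. x \<otimes> f) ` src \<gamma>" for \<gamma>
  have killed_carrier: "f \<in> carrier R" if "f \<in> killed P n" for f n using that by (simp add: killed_def)
  have src_submod: "submod (src \<gamma>)" for \<gamma>
  proof (rule submodI)
    show "src \<gamma> \<subseteq> carrier R" using killed_carrier by (auto simp: src_def)
    show "\<zero> \<in> src \<gamma>" using submod_zero[OF killed_submod[OF P_sub]] G_zero by (auto simp: src_def)
    show "f \<oplus> f' \<in> src \<gamma>" if "f \<in> src \<gamma>" "f' \<in> src \<gamma>" for f f'
      using that submod_add[OF killed_submod[OF P_sub]] G_add by (auto simp: src_def split: if_splits)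
    show "\<phi> a \<otimes> f \<in> src \<gamma>" if "a \<in> carrier A" "f \<in> src \<gamma>" for a f
      using that submod_smult[OF killed_submod[OF P_sub]] mult_component[OF phi_G[OF that(1)], of f "fst \<gamma> - e"]
      by (auto simp: src_def split: if_splits)
  qed
  have src_stable: "mon v \<otimes> f \<in> src (\<gamma> + wt v)" if "f \<in> src \<gamma>" for f v \<gamma>
  proof -
    have "mon v \<otimes> f \<in> killed P (snd (\<gamma> + wt v))"
      using killed_stable[OF P_sub, of f "snd \<gamma>" v] that by (simp add: src_def)
    moreover have "mon v \<otimes> f \<in> G (fst (\<gamma> + wt v) - e)" if le: "e \<le> fst \<gamma>"
      using mult_component[OF mon_G[of v], of f "fst \<gamma> - e"] \<open>f \<in> src \<gamma>\<close> le
      by (simp add: src_def add.commute)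
    ultimately show ?thesis using that G_zero by (cases "e \<le> fst \<gamma>") (auto simp: src_def)
  qed
  have image_submod: "submod ((\<lambda>f. x \<otimes> f) ` S)" if S: "submod S" for S
  proof (rule submodI)
    show "(\<lambda>f. x \<otimes> f) ` S \<subseteq> carrier R" using x submod_carrier[OF S] by auto
    show "\<zero> \<in> (\<lambda>f. x \<otimes> f) ` S" using submod_zero[OF S] x by (intro image_eqI[of _ _ \<zero>]) auto
    show "y \<oplus> y' \<in> (\<lambda>f. x \<otimes> f) ` S" if "y \<in> (\<lambda>f. x \<otimes> f) ` S" "y' \<in> (\<lambda>f. x \<otimes> f) ` S" for y y'
    proof -
      from that obtain f f' where f: "f \<in> S" "y = x \<otimes> f" "f' \<in> S" "y' = x \<otimes> f'" by auto
      then have "y \<oplus> y' = x \<otimes> (f \<oplus> f')" using x submod_carrier[OF S] by (simp add: r_distr)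
      then show ?thesis using submod_add[OF S f(1,3)] by blast
    qed
    show "\<phi> a \<otimes> y \<in> (\<lambda>f. x \<otimes> f) ` S" if "a \<in> carrier A" "y \<in> (\<lambda>f. x \<otimes> f) ` S" for a y
    proof -
      from that obtain f where f: "f \<in> S" "y = x \<otimes> f" by auto
      then have "\<phi> a \<otimes> y = x \<otimes> (\<phi> a \<otimes> f)" using that x submod_carrier[OF S] by (auto simp: m_lcomm)
      then show ?thesis using submod_smult[OF S that(1) f(1)] by blast
    qed
  qed
  have "\<exists>Hs. finite Hs \<and> (\<forall>(\<gamma>, h) \<in> Hs. h \<in> M \<gamma>) \<and>
    (\<forall>\<gamma>. M \<gamma> = aspan {mon v \<otimes> h | v \<gamma>' h. (\<gamma>', h) \<in> Hs \<and> \<gamma>' + wt v = \<gamma>})"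
  proof (rule finitely_generated_family[OF noeth])
    show "submod (M \<gamma>)" for \<gamma> unfolding M_def by (rule image_submod[OF src_submod])
    show "mon v \<otimes> y \<in> M (\<gamma> + wt v)" if "y \<in> M \<gamma>" for \<gamma> v y
    proof -
      from that obtain f where f: "f \<in> src \<gamma>" "y = x \<otimes> f" by (auto simp: M_def)
      then have "mon v \<otimes> y = x \<otimes> (mon v \<otimes> f)"
        using x submod_carrier[OF src_submod f(1)] by (simp add: m_lcomm)
      then show ?thesis using src_stable[OF f(1), of v] unfolding M_def by blast
    qed
    show "M \<gamma> \<subseteq> aspan (mon ` {w. wt w = \<gamma>})" for \<gamma>
    proof
      fix y assume "y \<in> M \<gamma>"
      then obtain f where f: "f \<in> src \<gamma>" "y = x \<otimes> f" by (auto simp: M_def)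
      show "y \<in> aspan (mon ` {w. wt w = \<gamma>})"
      proof (cases "e \<le> fst \<gamma>")
        case True
        then have "y \<in> G (fst \<gamma>)" using mult_component[OF x(3), of f "fst \<gamma> - e"] f by (simp add: src_def)
        moreover have "y \<in> ideal_pow R I (snd \<gamma>)" using f \<open>x \<in> P\<close> by (simp add: src_def killed_def)
        ultimately show ?thesis using ideal_pow_G_span[of y "snd \<gamma>" "fst \<gamma>"] by simp
      next
        case False
        then show ?thesis using f x by (simp add: src_def aspan.zero)
      qed
    qed
  qed
  then obtain Hs where Hs: "finite Hs" "\<And>\<gamma> h. (\<gamma>, h) \<in> Hs \<Longrightarrow> h \<in> M \<gamma>"
    "\<And>\<gamma>. M \<gamma> = aspan {mon v \<otimes> h | v \<gamma>' h. (\<gamma>', h) \<in> Hs \<and> \<gamma>' + wt v = \<gamma>}" by blast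
  \<comment> \<open>\<open>F j\<close> is the homogeneous element of \<open>I^n : P\<close> behind the generator \<open>x \<otimes> F j\<close>.\<close>
  define F where "F j = (SOME f. f \<in> src (fst j) \<and> snd j = x \<otimes> f)" for j
  have F: "F j \<in> src (fst j)" "snd j = x \<otimes> F j" if "j \<in> Hs" for j
  proof -
    have "snd j \<in> M (fst j)" using Hs(2)[of "fst j" "snd j"] that by simp
    then have "\<exists>f. f \<in> src (fst j) \<and> snd j = x \<otimes> f" unfolding M_def by blast
    from someI_ex[OF this] show "F j \<in> src (fst j)" "snd j = x \<otimes> F j" unfolding F_def by auto
  qed
  define E where "E j w \<longleftrightarrow> mon w \<otimes> F j \<notin> locally_zero P (snd (fst j) + snd (wt w))" for j w
  define D where "D n = {u. \<exists>f\<in>G u. P = colon R (ideal_pow R I n) f}" for n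
  have F_carrier: "F j \<in> carrier R" if "j \<in> Hs" for j using submod_carrier[OF src_submod F(1)[OF that]] .
  \<comment> \<open>A generator in degree less than \<open>e\<close> is zero, so none of its multiples survives.\<close>
  have e_le: "e \<le> fst (fst j)" if "j \<in> Hs" "E j w" for j w
  proof (rule ccontr)
    assume "\<not> e \<le> fst (fst j)"
    then have "mon w \<otimes> F j = \<zero>" using F(1)[OF that(1)] by (simp add: src_def)
    then show False using that(2) submod_zero[OF locally_zero_submod[OF prime]] by (simp add: E_def)
  qed
  \<comment> \<open>If \<open>f\<close> survives in the localization, so does one of the monomial multiples of generators of which it is a combination; these all have the bidegree of \<open>f\<close>, hence the degrees of witnesses are exactly those of surviving monomial multiples.\<close>
  have D_eq: "D n = {fst (fst j) - e + (\<Sum>i<m. \<delta> i * w i) | j w.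
      j \<in> Hs \<and> E j w \<and> snd (fst j) + (\<Sum>i<m. \<eta> i * w i) = n}" (is "_ = ?D n") for n
  proof
    show "?D n \<subseteq> D n"
    proof
      fix u assume "u \<in> ?D n"
      then obtain j w where j: "j \<in> Hs" and Ew: "E j w" and u: "u = fst (fst j) - e + fst (wt w)"
        and n: "snd (fst j) + snd (wt w) = n" by (auto simp: wt_def)
      have "F j \<in> G (fst (fst j) - e)" "F j \<in> killed P (snd (fst j))"
        using F(1)[OF j] e_le[OF j Ew] by (auto simp: src_def)
      then have "mon w \<otimes> F j \<in> G u" "mon w \<otimes> F j \<in> killed P n"
        using mult_component[OF mon_G[of w]] killed_stable[OF P_sub] u n by (auto simp: add.commute)
      moreover have "mon w \<otimes> F j \<notin> locally_zero P n" using Ew n by (simp add: E_def)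
      ultimately show "u \<in> D n"
        unfolding D_def using eq_colon_iff[OF P_sub, of "mon w \<otimes> F j" n] G_carrier by blast
    qed
    show "D n \<subseteq> ?D n"
    proof
      fix u assume "u \<in> D n"
      then obtain f where f: "f \<in> G u" "P = colon R (ideal_pow R I n) f" by (auto simp: D_def)
      have fc: "f \<in> carrier R" using f(1) by (rule G_carrier)
      have f_k: "f \<in> killed P n" and f_z: "f \<notin> locally_zero P n"
        using eq_colon_iff[OF P_sub fc, of n] f(2) by auto
      define B where "B = {mon v \<otimes> F j | v j. j \<in> Hs \<and> fst j + wt v = (u + e, n)}"
      have B_carrier: "B \<subseteq> carrier R" using F_carrier by (auto simp: B_def)
      have "x \<otimes> f \<in> M (u + e, n)" using f(1) f_k by (auto simp: M_def src_def)
      then have "x \<otimes> f \<in> aspan {mon v \<otimes> h | v \<gamma>' h. (\<gamma>', h) \<in> Hs \<and> \<gamma>' + wt v = (u + e, n)}"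
        using Hs(3) by blast
      moreover have "\<dots> \<subseteq> (\<lambda>f. x \<otimes> f) ` aspan B"
      proof (rule aspan_minimal[OF image_submod[OF aspan_submod[OF B_carrier]]], clarify)
        fix v a b h assume h: "((a, b), h) \<in> Hs" "(a, b) + wt v = (u + e, n)"
        have "mon v \<otimes> F ((a, b), h) \<in> aspan B"
          using h B_carrier by (intro aspan_incl) (auto simp: B_def)
        moreover have "mon v \<otimes> (x \<otimes> F ((a, b), h)) = x \<otimes> (mon v \<otimes> F ((a, b), h))"
          using F_carrier[OF h(1)] x by (simp add: m_lcomm)
        then have "mon v \<otimes> h = x \<otimes> (mon v \<otimes> F ((a, b), h))"
          by (simp only: F(2)[OF h(1), unfolded snd_conv, symmetric])
        ultimately show "mon v \<otimes> h \<in> (\<lambda>f. x \<otimes> f) ` aspan B" by blast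
      qed
      ultimately obtain f' where f': "f' \<in> aspan B" "x \<otimes> f = x \<otimes> f'" by blast
      have "f = f'" using f'(2) x fc aspan_carrier[OF f'(1) B_carrier] m_lcancel by blast
      then have "f \<in> aspan B" using f'(1) by simp
      then have "\<not> B \<subseteq> locally_zero P n"
        using aspan_minimal[OF locally_zero_submod[OF prime]] f_z by blast
      then obtain v j where j: "j \<in> Hs" "fst j + wt v = (u + e, n)" "mon v \<otimes> F j \<notin> locally_zero P n"
        unfolding B_def by blast
      have fs: "fst (fst j) + fst (wt v) = u + e" "snd (fst j) + snd (wt v) = n"
        using j(2) by (auto simp: plus_prod_def)
      have Ev: "E j v" using j(3) fs(2) by (simp add: E_def)
      then have "u = fst (fst j) - e + fst (wt v)" using e_le[OF j(1) Ev] fs(1) by simp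
      then show "u \<in> ?D n" using j(1) Ev fs(2)
        by (intro CollectI exI[of _ j] exI[of _ v]) (simp add: wt_def)
    qed
  qed
  have down: "E j w" if "j \<in> Hs" "E j w'" "\<And>i. i < m \<Longrightarrow> w i \<le> w' i" for j w w'
  proof (rule ccontr)
    assume "\<not> E j w"
    define v where "v = (\<lambda>i. w' i - w i)"
    have eq: "w i + v i = w' i" if "i < m" for i using \<open>\<And>i. i < m \<Longrightarrow> w i \<le> w' i\<close>[OF that] by (simp add: v_def)
    have w': "mon w' = mon w \<otimes> mon v" "wt w' = wt w + wt v"
      using mon_cong[of "\<lambda>i. w i + v i" w'] wt_cong[of "\<lambda>i. w i + v i" w'] eq
      by (auto simp: mon_add wt_add)
    have "mon v \<otimes> (mon w \<otimes> F j) \<in> locally_zero P (snd (fst j) + snd (wt w) + snd (wt v))"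
      using \<open>\<not> E j w\<close> locally_zero_stable by (simp add: E_def)
    moreover have "mon v \<otimes> (mon w \<otimes> F j) = mon w' \<otimes> F j"
      using w'(1) F_carrier[OF that(1)] by (simp add: m_ac)
    ultimately show False using that(2) w'(2) by (simp add: E_def add.assoc)
  qed
  have "D n \<noteq> {}" if "n \<ge> N" for n
    using ass_quot_homogeneous_witness[OF ideal_pow_ideal ideal_pow_homogeneous N[OF that]]
    unfolding D_def by blast
  from least_degree_eventually_linear[where D = D and E = E and J = Hs and \<delta> = \<delta> and \<eta> = \<eta>,
      OF Hs(1) eta_le down D_eq this]
  show ?thesis unfolding v_inv_def D_def by simp
qed

end

section \<open>The main theorem\<close>

lemma (in fg_graded_algebra) homogeneous_ring_generators:
  "\<exists>S. finite S \<and> S \<subseteq> (\<Union>u. G u) \<and> generate_ring R (\<phi> ` carrier A \<union> S) = carrier R"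
proof -
  obtain S where S: "S \<subseteq> carrier R" "finite S" "generate_ring R (\<phi> ` carrier A \<union> S) = carrier R"
    using finitely_generated by blast
  define S' where "S' = (\<Union>s\<in>S. (\<lambda>u. comp u s) ` {u. comp u s \<noteq> \<zero>})"
  have phi_carrier: "\<phi> ` carrier A \<subseteq> carrier R" using base_degree_zero G_carrier by blast
  have S'_carrier: "S' \<subseteq> carrier R" using S(1) by (auto simp: S'_def)
  have sub: "\<phi> ` carrier A \<union> S' \<subseteq> carrier R" using phi_carrier S'_carrier by blast
  interpret gen: subring "generate_ring R (\<phi> ` carrier A \<union> S')" R
    by (rule generate_ring_is_subring[OF sub])
  have "s \<in> generate_ring R (\<phi> ` carrier A \<union> S')" if s: "s \<in> S" for s
  proof -
    have sc: "s \<in> carrier R" using s S(1) by blast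
    have mem: "comp u s \<in> generate_ring R (\<phi> ` carrier A \<union> S')" if "comp u s \<noteq> \<zero>" for u
      using s that by (intro generate_ring.incl) (auto simp: S'_def)
    have "(\<Oplus>u\<in>U. comp u s) \<in> generate_ring R (\<phi> ` carrier A \<union> S')"
      if "finite U" "U \<subseteq> {u. comp u s \<noteq> \<zero>}" for U
      using that
    proof (induction U rule: finite_induct)
      case empty
      then show ?case using zero_in_generate by simp
    next
      case (insert u U)
      then show ?case using sc mem by (auto simp: finsum_insert intro: generate_ring.eng_add)
    qed
    then show ?thesis using comp_sum_support[OF sc] finite_comp[OF sc] by fastforce
  qed
  then have "generate_ring R (\<phi> ` carrier A \<union> S) \<subseteq> generate_ring R (\<phi> ` carrier A \<union> S')"
    by (intro generate_ring_min_subring1 generate_ring_is_subring sub)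
      (use phi_carrier S(1) generate_ring.incl[of _ "\<phi> ` carrier A \<union> S'" R] in auto)
  then have "generate_ring R (\<phi> ` carrier A \<union> S') = carrier R"
    using S(3) generate_ring_incl[OF sub] by blast
  moreover have "finite S'" using S finite_comp by (auto simp: S'_def)
  moreover have "S' \<subseteq> (\<Union>u. G u)" using S(1) comp_G by (auto simp: S'_def)
  ultimately show ?thesis by blast
qed

theorem theorem1p1:
  fixes A :: "('b, 'n) ring_scheme"
    and R :: "('a, 'm) ring_scheme"
    and \<phi> :: "'b \<Rightarrow> 'a"
    and G :: "nat \<Rightarrow> 'a set"
    and I P :: "'a set"
    and c :: nat
    and g :: "nat \<Rightarrow> 'a"
    and d :: "nat \<Rightarrow> nat"
  assumes "noetherian_ring A"
    and "domain R"
    and "fg_graded_algebra A R G \<phi>"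
    and "\<And>i. i \<in> {1..c} \<Longrightarrow> g i \<in> G (d i)"
    and "I = Idl\<^bsub>R\<^esub> (g ` {1..c})"
    and "I \<noteq> {\<zero>\<^bsub>R\<^esub>}"
    and "P \<in> asymptotic_ass R I"
  shows "\<exists>a \<in> d ` {1..c}. \<exists>b :: int. \<exists>n\<^sub>0 :: nat. \<forall>n \<ge> n\<^sub>0.
           int (v_inv R G P (ideal_pow R I n)) = int a * int n + b"
proof -
  interpret fg_graded_algebra A R G \<phi> by (rule assms(3))
  obtain S where S: "finite S" "S \<subseteq> (\<Union>u. G u)" "generate_ring R (\<phi> ` carrier A \<union> S) = carrier R"
    using homogeneous_ring_generators by blast
  obtain xs where xs: "set xs = S" using finite_list[OF S(1)] by blast
  define deg where "deg s = (SOME u. s \<in> G u)" for s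
  have deg: "s \<in> G (deg s)" if "s \<in> S" for s
    unfolding deg_def by (rule someI_ex) (use S(2) that in blast)
  define m where "m = c + length xs"
  define z where "z i = (if i < c then g (Suc i) else xs ! (i - c))" for i
  define \<delta> where "\<delta> i = (if i < c then d (Suc i) else deg (xs ! (i - c)))" for i
  define \<eta> where "\<eta> i = (if i < c then 1 else 0 :: nat)" for i
  have "z ` {i. i < m \<and> \<eta> i = 0} = S"
  proof -
    have "{i. i < m \<and> \<eta> i = 0} = (\<lambda>k. k + c) ` {..<length xs}"
    proof (intro equalityI subsetI)
      fix i assume "i \<in> {i. i < m \<and> \<eta> i = 0}"
      then show "i \<in> (\<lambda>k. k + c) ` {..<length xs}"
        by (intro image_eqI[of _ _ "i - c"]) (auto simp: m_def \<eta>_def split: if_splits)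
    qed (auto simp: m_def \<eta>_def)
    then have "z ` {i. i < m \<and> \<eta> i = 0} = (\<lambda>k. xs ! k) ` {..<length xs}"
      by (simp only: image_image) (simp add: z_def)
    then show ?thesis using xs by (auto simp: set_conv_nth)
  qed
  moreover have "z ` {i. i < m \<and> \<eta> i = 1} = g ` {1..c}"
  proof -
    have "{i. i < m \<and> \<eta> i = 1} = {..<c}" by (auto simp: m_def \<eta>_def split: if_splits)
    moreover have "z ` {..<c} = (\<lambda>i. g (Suc i)) ` {..<c}" by (rule image_cong) (auto simp: z_def)
    moreover have "{1..c} = Suc ` {..<c}" by (simp add: image_Suc_lessThan)
    ultimately show ?thesis by (simp only: image_image)
  qed
  ultimately interpret homogeneous_generators A R G \<phi> m z \<delta> \<eta> I
  proof (unfold_locales, goal_cases)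
    case 1
    show ?case by (rule structure_hom)
  next
    case 2
    show ?case by (rule base_degree_zero)
  next
    case (3 i)
    show ?case
    proof (cases "i < c")
      case True
      then show ?thesis using assms(4)[of "Suc i"] by (simp add: z_def \<delta>_def)
    next
      case False
      then have "xs ! (i - c) \<in> S" using 3 xs by (auto simp: m_def)
      then show ?thesis using False deg by (simp add: z_def \<delta>_def)
    qed
  next
    case (4 i)
    show ?case by (simp add: \<eta>_def)
  next
    case 5
    then show ?case using S(3) by simp
  next
    case 6
    then show ?case using assms(5) by simp
  qed
  obtain i b n\<^sub>0 where i: "i < m" "\<eta> i = 1"
    and lin: "\<forall>n\<ge>n\<^sub>0. int (v_inv R G P (ideal_pow R I n)) = int (\<delta> i) * int n + b"
    using v_inv_eventually_linear[OF assms(1,2,6,7)] by blast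
  have "i < c" using i(2) by (simp add: \<eta>_def split: if_splits)
  then have "\<delta> i \<in> d ` {1..c}" by (simp add: \<delta>_def)
  with lin show ?thesis by blast
qed

end
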